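(* Let $\mathcal{M}_3^{\mathrm{IG}},\mathcal{M}_3^{\Gamma},\mathcal{M}_3^{\mathrm{Gaussian}}\subseteq\mathbb{P}^3$ be the third moment varieties of the inverse Gaussian, gamma and Gaussian distributions, respectively. Their Euclidean distance degrees are $$\operatorname{EDdegree}(\mathcal{M}_3^{\mathrm{IG}})=12,\qquad \operatorname{EDdegree}(\mathcal{M}_3^{\Gamma})=10,\qquad \operatorname{EDdegree}(\mathcal{M}_3^{\mathrm{Gaussian}})=7.$$
   Context: For a distribution with moments $m_r(\theta)$ depending on parameters $\theta$, the moment variety $\mathcal{M}_3\subseteq\mathbb{P}^3$ is the Zariski closure of the set of points $[m_0(\theta):m_1(\theta):m_2(\theta):m_3(\theta)]$ over complex parameter values $\theta$. The moments are: for the inverse Gaussian ($\mu\in\mathbb{C}$, $\lambda\in\mathbb{C}\setminus\{0\}$), $m_0=1$, $m_1=\mu$, $m_i=\frac{2i-3}{\lambda}\mu^2m_{i-1}+\mu^2m_{i-2}$ for $i\ge2$; for the gamma ($k,\theta\in\mathbb{C}$), $m_i=\theta^i\prod_{j=0}^{i-1}(k+j)$; for the Gaussian ($\mu,\sigma^2\in\mathbb{C}$), $m_0=1$, $m_1=\mu$, $m_2=\mu^2+\sigma^2$, $m_3=\mu^3+3\mu\sigma^2$. The ED degree of $\mathcal{M}_3$ is the number of complex critical points, for generic $\widetilde m=(\widetilde m_1,\widetilde m_2,\widetilde m_3)\in\mathbb{C}^3$, of the squared distance $\sum_{i=1}^3(m_i-\widetilde m_i)^2$ on the (smooth locus of the)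 affine variety $\mathcal{M}_3\cap\{m_0=1\}\subseteq\mathbb{C}^3$. In each of these cases $\mathcal{M}_3\cap\{m_0=1\}$ is a hypersurface defined by a single irreducible polynomial $f\in\mathbb{C}[m_1,m_2,m_3]$, and the ED degree is the number of complex solutions $(m,k)\in\mathbb{C}^3\times\mathbb{C}$ of $f(m)=0$, $k\nabla f(m)-(m-\widetilde m)=0$ for generic $\widetilde m\in\mathbb{C}^3$. *)

theory Defs
  imports "HOL-Analysis.Analysis" "HOL-Library.Poly_Mapping"
begin

section \<open>Polynomials and Zariski closure\<close>

text \<open>Complex polynomials in variables indexed by \<^typ>\<open>'n\<close>: finitely supported maps from
  exponent vectors to coefficients.\<close>

type_synonym 'n cpoly = "('n \<Rightarrow>\<^sub>0 nat) \<Rightarrow>\<^sub>0 complex"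

definition eval_poly :: "'n::finite cpoly \<Rightarrow> complex ^ 'n \<Rightarrow> complex" where
  "eval_poly p x =
     (\<Sum>e\<in>Poly_Mapping.keys p. Poly_Mapping.lookup p e * (\<Prod>i\<in>UNIV. (x $ i) ^ Poly_Mapping.lookup e i))"

definition homogeneous :: "'n::finite cpoly \<Rightarrow> bool" where
  "homogeneous p \<longleftrightarrow>
     (\<exists>d. \<forall>e\<in>Poly_Mapping.keys p. (\<Sum>i\<in>UNIV. Poly_Mapping.lookup e i) = d)"

text \<open>A subset of projective space is represented by the set of all (nonzero) homogeneous
  coordinate vectors of its points; \<open>S\<close> may contain just one coordinate vector per point,
  since the vanishing of a homogeneous polynomial does not depend on this choice.\<close>

definition proj_zariski_closure :: "(complex ^ 'n::finite) set \<Rightarrow> (complex ^ 'n) set" where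
  "proj_zariski_closure S =
     {x. x \<noteq> 0 \<and> (\<forall>p. homogeneous p \<longrightarrow> (\<forall>y\<in>S. eval_poly p y = 0) \<longrightarrow> eval_poly p x = 0)}"

text \<open>Coordinates of projective 3-space are \<open>[m\<^sub>0 : m\<^sub>1 : m\<^sub>2 : m\<^sub>3]\<close>, stored in this order
  in \<^typ>\<open>complex ^ 4\<close> (so \<open>m\<^sub>i\<close> is the component \<open>i + 1\<close>); those of the affine chart
  \<open>m\<^sub>0 = 1\<close> are \<open>(m\<^sub>1, m\<^sub>2, m\<^sub>3)\<close>.\<close>

definition affine_part :: "(complex ^ 4) set \<Rightarrow> (complex ^ 3) set" where
  "affine_part M = {m. vector [1, m $ 1, m $ 2, m $ 3] \<in> M}"


section \<open>Euclidean distance degree\<close>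

definition dir_deriv :: "(complex ^ 'n \<Rightarrow> complex) \<Rightarrow> complex ^ 'n \<Rightarrow> complex ^ 'n \<Rightarrow> complex" where
  "dir_deriv F x v = deriv (\<lambda>t. F (x + t *s v)) 0"

definition vanishing_ideal :: "(complex ^ 'n::finite) set \<Rightarrow> 'n cpoly set" where
  "vanishing_ideal X = {p. \<forall>x\<in>X. eval_poly p x = 0}"

definition tangent_space :: "(complex ^ 'n::finite) set \<Rightarrow> complex ^ 'n \<Rightarrow> (complex ^ 'n) set" where
  "tangent_space X x = {v. \<forall>p\<in>vanishing_ideal X. dir_deriv (eval_poly p) x v = 0}"

text \<open>For an irreducible affine variety \<open>X\<close>, the dimension of \<open>X\<close> is the minimum of the (complex)
  dimensions of its tangent spaces, and the smooth points are those where it is attained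
  (equivalently, where the Jacobian of generators of the ideal has rank the codimension of \<open>X\<close>).
  The varieties considered here are closures of images of irreducible parameter spaces,
  hence irreducible.\<close>

definition smooth_locus :: "(complex ^ 'n::finite) set \<Rightarrow> (complex ^ 'n) set" where
  "smooth_locus X =
     {x \<in> X. \<forall>y\<in>X. vec.dim (tangent_space X x) \<le> vec.dim (tangent_space X y)}"

text \<open>The squared distance is the complex bilinear (not Hermitian) extension of the real one.\<close>

definition sq_dist :: "complex ^ 'n::finite \<Rightarrow> complex ^ 'n \<Rightarrow> complex" where
  "sq_dist u m = (\<Sum>i\<in>UNIV. (m $ i - u $ i) ^ 2)"

definition critical_points :: "(complex ^ 'n::finite) set \<Rightarrow> complex ^ 'n \<Rightarrow> (complex ^ 'n) set" where
  "critical_points X u =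
     {m \<in> smooth_locus X. \<forall>v\<in>tangent_space X m. dir_deriv (sq_dist u) m v = 0}"

text \<open>A property holds for generic \<open>u\<close> if it holds on a nonempty Zariski open set,
  equivalently on the nonvanishing locus of some nonzero polynomial.\<close>

definition generically :: "(complex ^ 'n::finite \<Rightarrow> bool) \<Rightarrow> bool" where
  "generically P \<longleftrightarrow> (\<exists>g::'n cpoly. g \<noteq> 0 \<and> (\<forall>u. eval_poly g u \<noteq> 0 \<longrightarrow> P u))"

text \<open>Stated as a relation; the number \<open>d\<close> is unique, because two nonempty Zariski open sets
  intersect.\<close>

definition has_ED_degree :: "(complex ^ 4) set \<Rightarrow> nat \<Rightarrow> bool" where
  "has_ED_degree M d \<longleftrightarrow>
     generically (\<lambda>u. finite (critical_points (affine_part M) u) \<and>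
                      card (critical_points (affine_part M) u) = d)"


section \<open>Moment varieties\<close>

definition moment_point :: "(nat \<Rightarrow> complex) \<Rightarrow> complex ^ 4" where
  "moment_point m = vector [m 0, m 1, m 2, m 3]"

text \<open>In the third equation the index is \<open>i = n + 2\<close>, so that \<open>2 i - 3 = 2 n + 1\<close>.\<close>

fun inverse_gaussian_moment :: "complex \<Rightarrow> complex \<Rightarrow> nat \<Rightarrow> complex" where
  "inverse_gaussian_moment \<mu> l 0 = 1"
| "inverse_gaussian_moment \<mu> l (Suc 0) = \<mu>"
| "inverse_gaussian_moment \<mu> l (Suc (Suc n)) =
     of_nat (2 * n + 1) / l * \<mu>\<^sup>2 * inverse_gaussian_moment \<mu> l (Suc n)
     + \<mu>\<^sup>2 * inverse_gaussian_moment \<mu> l n"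

definition gamma_moment :: "complex \<Rightarrow> complex \<Rightarrow> nat \<Rightarrow> complex" where
  "gamma_moment k \<theta> i = \<theta> ^ i * (\<Prod>j<i. k + of_nat j)"

text \<open>The parameter \<open>v\<close> is the variance \<open>\<sigma>\<^sup>2\<close>.\<close>

definition gaussian_moment_point :: "complex \<Rightarrow> complex \<Rightarrow> complex ^ 4" where
  "gaussian_moment_point \<mu> v = vector [1, \<mu>, \<mu>\<^sup>2 + v, \<mu> ^ 3 + 3 * \<mu> * v]"

definition M3_inverse_gaussian :: "(complex ^ 4) set" where
  "M3_inverse_gaussian =
     proj_zariski_closure {moment_point (inverse_gaussian_moment \<mu> l) |\<mu> l. l \<noteq> 0}"

definition M3_gamma :: "(complex ^ 4) set" where
  "M3_gamma = proj_zariski_closure {moment_point (gamma_moment k \<theta>) |k \<theta>. True}"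

definition M3_gaussian :: "(complex ^ 4) set" where
  "M3_gaussian = proj_zariski_closure {gaussian_moment_point \<mu> v |\<mu> v. True}"

end

theory Submission
  imports "HOL-Computational_Algebra.Field_as_Ring"
    "HOL-Computational_Algebra.Fundamental_Theorem_Algebra" "Subresultants.Subresultant_Gcd" Defs
begin

no_notation Matrix.vec_index (infixl "$" 100)

text \<open>Each affine variety is a surface on which \<open>m\<^sub>3\<close> is, off a line without critical points for
  generic data, a rational function of \<open>m\<^sub>1\<close> and \<open>m\<^sub>2\<close>: \<open>m\<^sub>1 m\<^sub>3 = \<alpha> m\<^sub>2\<^sup>2 - \<beta> m\<^sub>1\<^sup>2 m\<^sub>2 + \<gamma> m\<^sub>1\<^sup>4\<close> with
  \<open>(\<alpha>, \<beta>, \<gamma>) = (3, 3, 1)\<close> for the inverse Gaussian and \<open>(2, 1, 0)\<close> for the gamma distribution, and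
  \<open>m\<^sub>3 = 3 m\<^sub>1 m\<^sub>2 - 2 m\<^sub>1\<^sup>3\<close> for the Gaussian. Eliminating \<open>m\<^sub>2\<close> from the two critical equations
  leaves one polynomial in \<open>m\<^sub>1\<close>, of degree 12, 10 and 7 respectively, whose leading coefficient does not depend on
  the data point. Generically its roots are simple and each lifts to exactly one critical point.
  Both conditions are nonvanishing conditions on resultants, so they have to be checked at a single data
  point only, where explicit Bezout identities do this.\<close>

section \<open>Polynomial functions\<close>

text \<open>Three obstacles shape the argument. Tangent spaces are defined by the whole vanishing
  ideal, which is never determined: curves lying on the surface bound them from below, and the
  single known equation bounds them from above. The Zariski closure is likewise reached by limits: a
  polynomial vanishing on the moment points vanishes by continuity on the points that the
  distribution parameters miss, provided that these are approached along polynomial curves. Finally,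
  a resultant is a polynomial in the data point only if its Sylvester matrix has constant size. This
  is why the degrees of the eliminants are computed for every data point, while their roots are
  examined at one point only.\<close>

definition monomial_fun :: "('n::finite \<Rightarrow>\<^sub>0 nat) \<Rightarrow> complex ^ 'n \<Rightarrow> complex" where
  "monomial_fun e x = (\<Prod>i\<in>UNIV. (x $ i) ^ Poly_Mapping.lookup e i)"

lemma monomial_fun_add: "monomial_fun (d + e) x = monomial_fun d x * monomial_fun e x"
  by (simp add: monomial_fun_def lookup_add power_add prod.distrib)

lemma eval_poly_eq_sum:
  assumes "finite J" "Poly_Mapping.keys p \<subseteq> J"
  shows "eval_poly p x = (\<Sum>e\<in>J. Poly_Mapping.lookup p e * monomial_fun e x)"
  unfolding eval_poly_def monomial_fun_def
  using assms by (intro sum.mono_neutral_left) (auto simp: in_keys_iff)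

lemma eval_poly_add: "eval_poly (p + q) x = eval_poly p x + eval_poly q x"
proof -
  let ?J = "Poly_Mapping.keys p \<union> Poly_Mapping.keys q"
  show ?thesis
    using eval_poly_eq_sum[of ?J p x] eval_poly_eq_sum[of ?J q x] eval_poly_eq_sum[of ?J "p + q" x]
      Poly_Mapping.keys_add[of p q]
    by (simp add: lookup_add algebra_simps sum.distrib)
qed

lemma eval_poly_single: "eval_poly (Poly_Mapping.single e c) x = c * monomial_fun e x"
  using eval_poly_eq_sum[of "{e}" "Poly_Mapping.single e c" x] by simp

lemma eval_poly_zero: "eval_poly 0 x = 0"
  by (simp add: eval_poly_def)

text \<open>The choice \<open>K = {d}\<close> gives the forms of degree \<open>d\<close>.\<close>

definition graded_polyfun :: "nat set \<Rightarrow> (complex ^ 'n::finite \<Rightarrow> complex) \<Rightarrow> bool" where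
  "graded_polyfun K f \<longleftrightarrow>
     (\<exists>p. (\<forall>e\<in>Poly_Mapping.keys p. (\<Sum>i\<in>UNIV. Poly_Mapping.lookup e i) \<in> K) \<and> f = eval_poly p)"

abbreviation polyfun :: "(complex ^ 'n::finite \<Rightarrow> complex) \<Rightarrow> bool" where
  "polyfun \<equiv> graded_polyfun UNIV"

lemma polyfun_iff: "polyfun f \<longleftrightarrow> (\<exists>p. f = eval_poly p)"
  by (simp add: graded_polyfun_def)

lemma graded_polyfun_monomial:
  assumes "(\<Sum>i\<in>UNIV. Poly_Mapping.lookup e i) \<in> K"
  shows "graded_polyfun K (\<lambda>x. c * monomial_fun e x)"
  unfolding graded_polyfun_def
  using assms by (intro exI[of _ "Poly_Mapping.single e c"]) (auto simp: eval_poly_single fun_eq_iff)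

lemma graded_polyfun_add:
  assumes "graded_polyfun K f" "graded_polyfun K g"
  shows "graded_polyfun K (\<lambda>x. f x + g x)"
proof -
  obtain p q where "\<forall>e\<in>Poly_Mapping.keys p. (\<Sum>i\<in>UNIV. Poly_Mapping.lookup e i) \<in> K" "f = eval_poly p"
    "\<forall>e\<in>Poly_Mapping.keys q. (\<Sum>i\<in>UNIV. Poly_Mapping.lookup e i) \<in> K" "g = eval_poly q"
    using assms by (auto simp: graded_polyfun_def)
  then show ?thesis
    using Poly_Mapping.keys_add[of p q] unfolding graded_polyfun_def
    by (intro exI[of _ "p + q"]) (auto simp: eval_poly_add)
qed

lemma graded_polyfun_zero: "graded_polyfun K (\<lambda>x. 0)"
  unfolding graded_polyfun_def by (intro exI[of _ 0]) (auto simp: eval_poly_zero)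

lemma graded_polyfun_sum:
  "(\<And>j. j \<in> J \<Longrightarrow> graded_polyfun K (f j)) \<Longrightarrow> graded_polyfun K (\<lambda>x. \<Sum>j\<in>J. f j x)"
  by (induction J rule: infinite_finite_induct) (auto intro: graded_polyfun_zero graded_polyfun_add)

lemma eval_poly_monomials:
  "eval_poly p = (\<lambda>x. \<Sum>e\<in>Poly_Mapping.keys p. Poly_Mapping.lookup p e * monomial_fun e x)"
  by (simp add: fun_eq_iff eval_poly_def monomial_fun_def)

lemma graded_polyfun_mult:
  assumes "graded_polyfun K f" "graded_polyfun L g" "\<And>k l. k \<in> K \<Longrightarrow> l \<in> L \<Longrightarrow> k + l \<in> M"
  shows "graded_polyfun M (\<lambda>x. f x * g x)"
proof -
  obtain p q where p: "\<And>e. e \<in> Poly_Mapping.keys p \<Longrightarrow> (\<Sum>i\<in>UNIV. Poly_Mapping.lookup e i) \<in> K" "f = eval_poly p"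
    and q: "\<And>e. e \<in> Poly_Mapping.keys q \<Longrightarrow> (\<Sum>i\<in>UNIV. Poly_Mapping.lookup e i) \<in> L" "g = eval_poly q"
    using assms(1,2) unfolding graded_polyfun_def by blast
  have "f x * g x = (\<Sum>d\<in>Poly_Mapping.keys p. \<Sum>e\<in>Poly_Mapping.keys q.
      (Poly_Mapping.lookup p d * Poly_Mapping.lookup q e) * monomial_fun (d + e) x)" for x
    by (simp add: p q eval_poly_monomials sum_product monomial_fun_add algebra_simps)
  moreover have "graded_polyfun M (\<lambda>x. \<Sum>d\<in>Poly_Mapping.keys p. \<Sum>e\<in>Poly_Mapping.keys q.
      (Poly_Mapping.lookup p d * Poly_Mapping.lookup q e) * monomial_fun (d + e) x)"
    using p(1) q(1) assms(3)
    by (intro graded_polyfun_sum graded_polyfun_monomial) (auto simp: lookup_add sum.distrib)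
  ultimately show ?thesis by presburger
qed

lemma graded_polyfun_const: "0 \<in> K \<Longrightarrow> graded_polyfun K (\<lambda>x. c)"
  using graded_polyfun_monomial[of 0 K c] by (simp add: monomial_fun_def)

lemma graded_polyfun_cmult: "graded_polyfun K f \<Longrightarrow> graded_polyfun K (\<lambda>x. c * f x)"
  by (rule graded_polyfun_mult[of "{0}"]) (auto intro: graded_polyfun_const)

lemma monomial_fun_unit: "monomial_fun (Poly_Mapping.single i 1) x = x $ i"
proof -
  have "monomial_fun (Poly_Mapping.single i 1) x = (\<Prod>j\<in>UNIV. if j = i then x $ i else 1)"
    unfolding monomial_fun_def by (intro prod.cong) (auto simp: lookup_single when_def)
  then show ?thesis by simp
qed

lemma graded_polyfun_component:
  assumes "1 \<in> K"
  shows "graded_polyfun K (\<lambda>x. x $ i)"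
proof -
  have "(\<Sum>j\<in>UNIV. Poly_Mapping.lookup (Poly_Mapping.single i 1) j) = (\<Sum>j\<in>UNIV. if j = i then 1 else 0 :: nat)"
    by (intro sum.cong) (auto simp: lookup_single when_def)
  then show ?thesis
    using graded_polyfun_monomial[of "Poly_Mapping.single i 1" K 1] assms
    by (simp only: monomial_fun_unit mult_1) simp
qed

lemma polyfun_mult: "polyfun f \<Longrightarrow> polyfun g \<Longrightarrow> polyfun (\<lambda>x. f x * g x)"
  by (rule graded_polyfun_mult) auto

lemma graded_polyfun_diff:
  assumes "graded_polyfun K f" "graded_polyfun K g"
  shows "graded_polyfun K (\<lambda>x. f x - g x)"
  using graded_polyfun_add[OF assms(1) graded_polyfun_cmult[OF assms(2), of "-1"]] by simp

lemma polyfun_prod: "(\<And>j. j \<in> J \<Longrightarrow> polyfun (f j)) \<Longrightarrow> polyfun (\<lambda>x. \<Prod>j\<in>J. f j x)"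
  by (induction J rule: infinite_finite_induct) (auto intro: graded_polyfun_const polyfun_mult)

lemma graded_polyfun_power:
  assumes "graded_polyfun {d} f"
  shows "graded_polyfun {n * d} (\<lambda>x. f x ^ n)"
proof (induction n)
  case (Suc n)
  show ?case
    using graded_polyfun_mult[OF assms Suc] by simp
qed (auto intro: graded_polyfun_const)

lemma polyfun_If: "polyfun f \<Longrightarrow> polyfun g \<Longrightarrow> polyfun (\<lambda>x. if b then f x else g x)"
  by (cases b) simp_all

lemma polyfun_power: "polyfun f \<Longrightarrow> polyfun (\<lambda>x. f x ^ n)"
  by (induction n) (auto intro: graded_polyfun_const polyfun_mult)

text \<open>Constants and coordinates generate all polynomial functions under sum and product, so
  analytic facts such as continuity and the chain rule can be proved without handling exponent
  vectors.\<close>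

lemma eval_poly_induct [case_names const component add mult]:
  assumes "\<And>c. Q (\<lambda>x. c)" "\<And>i. Q (\<lambda>x. x $ i)"
    and add: "\<And>f g. Q f \<Longrightarrow> Q g \<Longrightarrow> Q (\<lambda>x. f x + g x)"
    and mult: "\<And>f g. Q f \<Longrightarrow> Q g \<Longrightarrow> Q (\<lambda>x. f x * g x)"
  shows "Q (eval_poly p)"
proof -
  have pow: "Q (\<lambda>x. (x $ i) ^ n)" for i n
    by (induction n) (auto intro: assms)
  have prod: "Q (\<lambda>x. \<Prod>i\<in>J. (x $ i) ^ e i)" for J e
    by (induction J rule: infinite_finite_induct) (auto intro: assms pow)
  have scaled: "Q (\<lambda>x. c * (\<Prod>i\<in>J. (x $ i) ^ e i))" for c J e
    using mult[OF assms(1) prod] .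
  have "Q (\<lambda>x. \<Sum>e\<in>J. c e * (\<Prod>i\<in>UNIV. (x $ i) ^ Poly_Mapping.lookup e i))" for J c
    by (induction J rule: infinite_finite_induct) (simp_all add: assms(1) add[OF scaled])
  then show ?thesis
    unfolding eval_poly_def .
qed

section \<open>Genericity\<close>

text \<open>The base point \<open>u0\<close> is shared by all conditions: their witnesses are
  nonzero there, hence so is the product, and conjunctions of generic conditions stay generic
  without an argument about zero divisors.\<close>

definition generic_at :: "complex ^ 'n::finite \<Rightarrow> (complex ^ 'n \<Rightarrow> bool) \<Rightarrow> bool" where
  "generic_at u0 Q \<longleftrightarrow> (\<exists>g. polyfun g \<and> g u0 \<noteq> 0 \<and> (\<forall>u. g u \<noteq> 0 \<longrightarrow> Q u))"

lemma generic_at_conj: "generic_at u0 Q \<Longrightarrow> generic_at u0 R \<Longrightarrow> generic_at u0 (\<lambda>u. Q u \<and> R u)"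
  unfolding generic_at_def
proof (elim exE conjE)
  fix g h :: "complex ^ 'a \<Rightarrow> complex"
  assume "polyfun g" "g u0 \<noteq> 0" "\<forall>u. g u \<noteq> 0 \<longrightarrow> Q u" "polyfun h" "h u0 \<noteq> 0" "\<forall>u. h u \<noteq> 0 \<longrightarrow> R u"
  then show "\<exists>g. polyfun g \<and> g u0 \<noteq> 0 \<and> (\<forall>u. g u \<noteq> 0 \<longrightarrow> Q u \<and> R u)"
    by (intro exI[of _ "\<lambda>u. g u * h u"]) (auto intro: polyfun_mult)
qed

lemma generic_at_imp_generically:
  assumes "generic_at u0 Q" "\<And>u. Q u \<Longrightarrow> R u"
  shows "generically R"
proof -
  obtain p where "eval_poly p u0 \<noteq> 0" "\<forall>u. eval_poly p u \<noteq> 0 \<longrightarrow> Q u"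
    using assms by (auto simp: generic_at_def polyfun_iff)
  then show ?thesis
    using assms(2) unfolding generically_def by (intro exI[of _ p]) (auto simp: eval_poly_zero)
qed

lemma generic_at_nonzero: "polyfun g \<Longrightarrow> g u0 \<noteq> 0 \<Longrightarrow> generic_at u0 (\<lambda>u. g u \<noteq> 0)"
  by (auto simp: generic_at_def)

section \<open>Univariate polynomials depending polynomially on the data point\<close>

definition polyfun_coeffs :: "(complex ^ 'n::finite \<Rightarrow> complex poly) \<Rightarrow> bool" where
  "polyfun_coeffs P \<longleftrightarrow> (\<forall>i. polyfun (\<lambda>u. coeff (P u) i))"

lemma polyfun_coeffs_const: "polyfun_coeffs (\<lambda>u. P)"
  by (auto simp: polyfun_coeffs_def intro: graded_polyfun_const)

lemma polyfun_coeffs_add: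
  "polyfun_coeffs P \<Longrightarrow> polyfun_coeffs Q \<Longrightarrow> polyfun_coeffs (\<lambda>u. P u + Q u)"
  by (auto simp: polyfun_coeffs_def intro: graded_polyfun_add)

lemma polyfun_coeffs_diff:
  "polyfun_coeffs P \<Longrightarrow> polyfun_coeffs Q \<Longrightarrow> polyfun_coeffs (\<lambda>u. P u - Q u)"
  by (auto simp: polyfun_coeffs_def intro: graded_polyfun_diff)

lemma polyfun_coeffs_mult:
  "polyfun_coeffs P \<Longrightarrow> polyfun_coeffs Q \<Longrightarrow> polyfun_coeffs (\<lambda>u. P u * Q u)"
  by (auto simp: polyfun_coeffs_def coeff_mult intro!: graded_polyfun_sum polyfun_mult)

lemma polyfun_coeffs_power: "polyfun_coeffs P \<Longrightarrow> polyfun_coeffs (\<lambda>u. P u ^ n)"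
  by (induction n) (auto intro: polyfun_coeffs_const polyfun_coeffs_mult)

lemma polyfun_coeffs_pCons:
  "polyfun f \<Longrightarrow> polyfun_coeffs P \<Longrightarrow> polyfun_coeffs (\<lambda>u. pCons (f u) (P u))"
  unfolding polyfun_coeffs_def coeff_pCons
proof
  fix i assume "polyfun f" "\<forall>i. polyfun (\<lambda>u. coeff (P u) i)"
  then show "polyfun (\<lambda>u. case i of 0 \<Rightarrow> f u | Suc j \<Rightarrow> coeff (P u) j)"
    by (cases i) auto
qed

lemma polyfun_coeffs_pderiv: "polyfun_coeffs P \<Longrightarrow> polyfun_coeffs (\<lambda>u. pderiv (P u))"
  unfolding polyfun_coeffs_def coeff_pderiv
  by (auto intro: graded_polyfun_cmult)

lemmas polyfun_intros =
  graded_polyfun_const graded_polyfun_component graded_polyfun_add graded_polyfun_diff polyfun_mult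
  polyfun_power polyfun_coeffs_const polyfun_coeffs_add polyfun_coeffs_diff polyfun_coeffs_mult
  polyfun_coeffs_power polyfun_coeffs_pCons

text \<open>Constant degrees fix the size of the Sylvester matrix; the Leibniz expansion of its
  determinant is then one polynomial expression in the coefficients.\<close>

lemma polyfun_resultant:
  assumes "polyfun_coeffs P" "polyfun_coeffs Q" "\<And>u. degree (P u) = m" "\<And>u. degree (Q u) = n"
  shows "polyfun (\<lambda>u. resultant (P u) (Q u))"
proof -
  have entry: "polyfun (\<lambda>u. sylvester_mat_sub m n (P u) (Q u) $$ (i, j))"
    if "i < m + n" "j < m + n" for i j
    using assms(1,2) that
    by (auto simp: sylvester_mat_sub_index polyfun_coeffs_def intro!: polyfun_If graded_polyfun_const)
  have "polyfun (\<lambda>u. Determinant.det (sylvester_mat_sub m n (P u) (Q u)))"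
    unfolding Determinant.det_def sylvester_mat_sub_dim
    by (auto intro!: graded_polyfun_sum polyfun_mult polyfun_prod graded_polyfun_const entry
        simp: permutes_in_image)
  then show ?thesis
    by (simp add: resultant_sub resultant_sub_def assms)
qed

text \<open>A vanishing resultant means a nonconstant gcd, and over the complex numbers such a gcd
  has a root. Nonconstancy of \<open>p\<close> keeps the gcd nonzero.\<close>

lemma resultant_nonzero_iff_no_common_root:
  fixes p q :: "complex poly"
  assumes "degree p \<noteq> 0"
  shows "resultant p q \<noteq> 0 \<longleftrightarrow> (\<forall>z. \<not> (poly p z = 0 \<and> poly q z = 0))"
proof
  assume "resultant p q \<noteq> 0"
  then have "degree (gcd p q) = 0"
    by (simp add: resultant_0_gcd)
  moreover have "gcd p q \<noteq> 0"
    using assms by auto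
  ultimately have unit: "is_unit (gcd p q)"
    by (simp add: is_unit_iff_degree)
  show "\<forall>z. \<not> (poly p z = 0 \<and> poly q z = 0)"
  proof safe
    fix z assume "poly p z = 0" "poly q z = 0"
    then have "[:-z, 1:] dvd gcd p q"
      by (simp add: poly_eq_0_iff_dvd)
    then have "is_unit [:-z, 1:]"
      using unit dvd_trans by blast
    then show False
      by (simp add: is_unit_iff_degree)
  qed
next
  assume nocommon: "\<forall>z. \<not> (poly p z = 0 \<and> poly q z = 0)"
  show "resultant p q \<noteq> 0"
  proof
    assume "resultant p q = 0"
    then have "degree (gcd p q) \<noteq> 0"
      by (simp add: resultant_0_gcd)
    then obtain z where "poly (gcd p q) z = 0"
      using fundamental_theorem_of_algebra[of "gcd p q"] constant_degree by metis
    then have "[:-z, 1:] dvd p" "[:-z, 1:] dvd q"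
      using dvd_trans gcd_dvd1 gcd_dvd2 by (metis poly_eq_0_iff_dvd)+
    then show False
      using nocommon by (auto simp: poly_eq_0_iff_dvd)
  qed
qed

lemma generic_no_common_root:
  assumes "polyfun_coeffs P" "polyfun_coeffs Q"
    and "\<And>u. degree (P u) = m" "\<And>u. degree (Q u) = n" "m \<noteq> 0"
    and "\<And>z. poly (P u0) z = 0 \<Longrightarrow> poly (Q u0) z = 0 \<Longrightarrow> False"
  shows "generic_at u0 (\<lambda>u. \<forall>z. \<not> (poly (P u) z = 0 \<and> poly (Q u) z = 0))"
proof -
  have "resultant (P u) (Q u) \<noteq> 0 \<longleftrightarrow> (\<forall>z. \<not> (poly (P u) z = 0 \<and> poly (Q u) z = 0))" for u
    using assms(3,5) by (intro resultant_nonzero_iff_no_common_root) auto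
  then show ?thesis
    using generic_at_nonzero[OF polyfun_resultant[OF assms(1-4)], of u0] assms(6) by auto
qed

text \<open>With simple roots only, \<open>p\<close> is its leading coefficient times one linear
  factor per element of the root set.\<close>

lemma rsquarefree_card_roots:
  fixes p :: "complex poly"
  assumes "p \<noteq> 0" "rsquarefree p"
  shows "card {z. poly p z = 0} = degree p"
proof -
  have "degree p = degree (Polynomial.smult (lead_coeff p) (\<Prod>z|poly p z = 0. [:-z, 1:]))"
    by (subst complex_poly_decompose_rsquarefree) (use assms in auto)
  also have "\<dots> = card {z. poly p z = 0}"
    using assms by (simp add: degree_prod_sum_eq)
  finally show ?thesis ..
qed

lemma generic_card_roots:
  assumes P: "polyfun_coeffs P" "\<And>u. degree (P u) = d" "d \<noteq> 0"
    and "\<And>z. poly (P u0) z = 0 \<Longrightarrow> poly (pderiv (P u0)) z = 0 \<Longrightarrow> False"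
  shows "generic_at u0 (\<lambda>u. card {z. poly (P u) z = 0} = d)"
proof -
  \<comment> \<open>In characteristic zero the derivative has degree \<open>d - 1\<close> for every
    \<open>u\<close>, so its resultant with \<open>P u\<close> qualifies as well.\<close>
  have "generic_at u0 (\<lambda>u. \<forall>z. \<not> (poly (P u) z = 0 \<and> poly (pderiv (P u)) z = 0))"
    using assms by (intro generic_no_common_root[where m = d and n = "d - 1"])
      (auto intro: polyfun_coeffs_pderiv simp: degree_pderiv)
  moreover have "card {z. poly (P u) z = 0} = d"
    if "\<forall>z. \<not> (poly (P u) z = 0 \<and> poly (pderiv (P u)) z = 0)" for u
  proof -
    have "P u \<noteq> 0"
      using P(2)[of u] P(3) by auto
    then show ?thesis
      using rsquarefree_card_roots[of "P u"] that P(2)[of u] by (simp add: rsquarefree_roots)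
  qed
  ultimately show ?thesis
    unfolding generic_at_def by blast
qed

section \<open>Tangent spaces and critical points\<close>

text \<open>\<open>G\<close> is the gradient at \<open>m\<close>. It is chosen before the curve, so
  the derivative depends linearly on the velocity; this later makes tangent spaces linear
  subspaces.\<close>

lemma eval_poly_chain_rule:
  "\<exists>G. \<forall>\<gamma> \<gamma>'. \<gamma> 0 = m \<longrightarrow> (\<forall>i. ((\<lambda>w. \<gamma> w $ i) has_field_derivative \<gamma>' $ i) (at 0)) \<longrightarrow>
     ((\<lambda>w. eval_poly p (\<gamma> w)) has_field_derivative (\<Sum>i\<in>UNIV. G $ i * \<gamma>' $ i)) (at 0)"
proof (induction rule: eval_poly_induct)
  case (const c)
  show ?case by (intro exI[of _ 0]) auto
next
  case (component i)
  have "(\<Sum>j\<in>UNIV. axis i 1 $ j * v $ j) = v $ i" for v :: "complex ^ 'a"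
    by (simp add: axis_def if_distrib[of "\<lambda>x. x * _"] cong: if_cong)
  then show ?case by (intro exI[of _ "axis i 1"]) auto
next
  case (add f g)
  then obtain F G where
    "\<forall>\<gamma> \<gamma>'. \<gamma> 0 = m \<longrightarrow> (\<forall>i. ((\<lambda>w. \<gamma> w $ i) has_field_derivative \<gamma>' $ i) (at 0)) \<longrightarrow>
     ((\<lambda>w. f (\<gamma> w)) has_field_derivative (\<Sum>i\<in>UNIV. F $ i * \<gamma>' $ i)) (at 0)"
    "\<forall>\<gamma> \<gamma>'. \<gamma> 0 = m \<longrightarrow> (\<forall>i. ((\<lambda>w. \<gamma> w $ i) has_field_derivative \<gamma>' $ i) (at 0)) \<longrightarrow>
     ((\<lambda>w. g (\<gamma> w)) has_field_derivative (\<Sum>i\<in>UNIV. G $ i * \<gamma>' $ i)) (at 0)"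
    by blast
  then show ?case
    by (intro exI[of _ "F + G"]) (auto simp: distrib_right sum.distrib intro!: DERIV_add)
next
  case (mult f g)
  then obtain F G where FG:
    "\<forall>\<gamma> \<gamma>'. \<gamma> 0 = m \<longrightarrow> (\<forall>i. ((\<lambda>w. \<gamma> w $ i) has_field_derivative \<gamma>' $ i) (at 0)) \<longrightarrow>
     ((\<lambda>w. f (\<gamma> w)) has_field_derivative (\<Sum>i\<in>UNIV. F $ i * \<gamma>' $ i)) (at 0)"
    "\<forall>\<gamma> \<gamma>'. \<gamma> 0 = m \<longrightarrow> (\<forall>i. ((\<lambda>w. \<gamma> w $ i) has_field_derivative \<gamma>' $ i) (at 0)) \<longrightarrow>
     ((\<lambda>w. g (\<gamma> w)) has_field_derivative (\<Sum>i\<in>UNIV. G $ i * \<gamma>' $ i)) (at 0)"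
    by blast
  have "(\<Sum>i\<in>UNIV. (g m *s F + f m *s G) $ i * v $ i) =
      (\<Sum>i\<in>UNIV. F $ i * v $ i) * g m + (\<Sum>i\<in>UNIV. G $ i * v $ i) * f m" for v :: "complex ^ 'a"
    by (simp add: distrib_right sum.distrib sum_distrib_left algebra_simps)
  then show ?case
    using FG by (intro exI[of _ "g m *s F + f m *s G"]) (auto intro!: DERIV_mult)
qed

lemma dir_deriv_eqI:
  assumes "((\<lambda>t. F (x + t *s v)) has_field_derivative D) (at 0)"
  shows "dir_deriv F x v = D"
  using assms unfolding dir_deriv_def by (rule DERIV_imp_deriv)

lemma eval_poly_gradient:
  obtains G where "\<And>v. dir_deriv (eval_poly p) m v = (\<Sum>i\<in>UNIV. G $ i * v $ i)"
    and "\<And>\<gamma> \<gamma>'. \<gamma> 0 = m \<Longrightarrow> (\<And>i. ((\<lambda>w. \<gamma> w $ i) has_field_derivative \<gamma>' $ i) (at 0)) \<Longrightarrow>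
      ((\<lambda>w. eval_poly p (\<gamma> w)) has_field_derivative (\<Sum>i\<in>UNIV. G $ i * \<gamma>' $ i)) (at 0)"
proof -
  obtain G where G: "\<And>\<gamma> \<gamma>'. \<gamma> 0 = m \<Longrightarrow> (\<And>i. ((\<lambda>w. \<gamma> w $ i) has_field_derivative \<gamma>' $ i) (at 0)) \<Longrightarrow>
      ((\<lambda>w. eval_poly p (\<gamma> w)) has_field_derivative (\<Sum>i\<in>UNIV. G $ i * \<gamma>' $ i)) (at 0)"
    using eval_poly_chain_rule[of m p] by blast
  have "dir_deriv (eval_poly p) m v = (\<Sum>i\<in>UNIV. G $ i * v $ i)" for v
    by (intro dir_deriv_eqI G) (auto intro!: derivative_eq_intros)
  then show ?thesis
    using G that by blast
qed

text \<open>Every element of the ideal is identically zero along the curve near 0, so its gradient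
  annihilates the velocity. This yields tangent vectors without generators of the ideal.\<close>

lemma curve_tangent_in_tangent_space:
  assumes "\<gamma> 0 = m" "\<And>i. ((\<lambda>w. \<gamma> w $ i) has_field_derivative \<gamma>' $ i) (at 0)"
    and "eventually (\<lambda>w. \<gamma> w \<in> X) (nhds 0)"
  shows "\<gamma>' \<in> tangent_space X m"
  unfolding tangent_space_def
proof (clarify)
  fix p assume p: "p \<in> vanishing_ideal X"
  obtain G where G: "\<And>v. dir_deriv (eval_poly p) m v = (\<Sum>i\<in>UNIV. G $ i * v $ i)"
    and "((\<lambda>w. eval_poly p (\<gamma> w)) has_field_derivative (\<Sum>i\<in>UNIV. G $ i * \<gamma>' $ i)) (at 0)"
    using eval_poly_gradient[of p m] assms by metis
  moreover have "eventually (\<lambda>w. eval_poly p (\<gamma> w) = 0) (nhds 0)"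
    using assms(3) p by (auto simp: vanishing_ideal_def elim: eventually_mono)
  ultimately have "((\<lambda>w. 0) has_field_derivative (\<Sum>i\<in>UNIV. G $ i * \<gamma>' $ i)) (at 0)"
    by (subst (asm) DERIV_cong_ev[OF refl _ refl]) auto
  then show "dir_deriv (eval_poly p) m \<gamma>' = 0"
    using G DERIV_unique[OF _ DERIV_const] by metis
qed

lemma subspace_tangent_space: "vec.subspace (tangent_space X m)"
proof (rule vec.subspaceI)
  show "0 \<in> tangent_space X m"
    by (auto simp: tangent_space_def dir_deriv_def)
  show "v + w \<in> tangent_space X m" if "v \<in> tangent_space X m" "w \<in> tangent_space X m" for v w
    unfolding tangent_space_def
  proof clarify
    fix p assume p: "p \<in> vanishing_ideal X"
    obtain G where G: "\<And>v. dir_deriv (eval_poly p) m v = (\<Sum>i\<in>UNIV. G $ i * v $ i)"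
      using eval_poly_gradient[of p m] by metis
    then have "dir_deriv (eval_poly p) m (v + w) = dir_deriv (eval_poly p) m v + dir_deriv (eval_poly p) m w"
      by (simp add: distrib_left sum.distrib)
    then show "dir_deriv (eval_poly p) m (v + w) = 0"
      using that p by (simp add: tangent_space_def)
  qed
  show "c *s v \<in> tangent_space X m" if "v \<in> tangent_space X m" for c v
    unfolding tangent_space_def
  proof clarify
    fix p assume "p \<in> vanishing_ideal X"
    moreover obtain G where G: "\<And>v. dir_deriv (eval_poly p) m v = (\<Sum>i\<in>UNIV. G $ i * v $ i)"
      using eval_poly_gradient[of p m] by metis
    moreover have "(\<Sum>i\<in>UNIV. G $ i * (c *s v) $ i) = c * (\<Sum>i\<in>UNIV. G $ i * v $ i)"
      by (simp add: sum_distrib_left algebra_simps)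
    ultimately show "dir_deriv (eval_poly p) m (c *s v) = 0"
      using that by (auto simp: tangent_space_def)
  qed
qed

section \<open>Tangent planes of surfaces that are locally graphs\<close>

lemma vec3_eqI: "x $ 1 = y $ 1 \<Longrightarrow> x $ 2 = y $ 2 \<Longrightarrow> x $ 3 = y $ 3 \<Longrightarrow> x = (y :: 'a ^ 3)"
  by (auto simp: vec_eq_iff forall_3)

lemma tangent_vector3I:
  assumes "(x has_field_derivative x') (at 0)" "(y has_field_derivative y') (at 0)"
    "(z has_field_derivative z') (at 0)" "vector [x 0, y 0, z 0] = m"
    and "eventually (\<lambda>w. vector [x w, y w, z w] \<in> X) (nhds 0)"
  shows "vector [x', y', z'] \<in> tangent_space (X :: (complex ^ 3) set) m"
proof (rule curve_tangent_in_tangent_space)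
  show "((\<lambda>w. vector [x w, y w, z w] $ i) has_field_derivative vector [x', y', z'] $ i) (at 0)" for i :: 3
    using exhaust_3[of i] assms(1-3) by auto
qed (use assms in auto)

text \<open>A vector \<open>e\<close> on which the linear form takes the value 1 lies outside the
  kernel and spans the whole space together with it.\<close>

lemma dim_hyperplane3:
  fixes a b c :: complex
  assumes "a \<noteq> 0 \<or> b \<noteq> 0 \<or> c \<noteq> 0"
  shows "vec.dim {v :: complex ^ 3. a * v $ 1 + b * v $ 2 + c * v $ 3 = 0} = 2"
proof -
  define H where "H = {v :: complex ^ 3. a * v $ 1 + b * v $ 2 + c * v $ 3 = 0}"
  obtain e :: "complex ^ 3" where e: "a * e $ 1 + b * e $ 2 + c * e $ 3 = 1"
  proof -
    consider "a \<noteq> 0" | "b \<noteq> 0" | "c \<noteq> 0"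
      using assms by blast
    then show ?thesis
    proof cases
      case 1
      then show ?thesis by (intro that[of "vector [1 / a, 0, 0]"]) simp
    next
      case 2
      then show ?thesis by (intro that[of "vector [0, 1 / b, 0]"]) simp
    next
      case 3
      then show ?thesis by (intro that[of "vector [0, 0, 1 / c]"]) simp
    qed
  qed
  have H: "vec.subspace H"
  proof (rule vec.subspaceI)
    show "x + y \<in> H" if "x \<in> H" "y \<in> H" for x y
    proof -
      have "a * (x + y) $ 1 + b * (x + y) $ 2 + c * (x + y) $ 3 =
          (a * x $ 1 + b * x $ 2 + c * x $ 3) + (a * y $ 1 + b * y $ 2 + c * y $ 3)"
        by (simp add: algebra_simps)
      then show ?thesis using that by (simp add: H_def)
    qed
    show "r *s x \<in> H" if "x \<in> H" for r x
    proof -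
      have "a * (r *s x) $ 1 + b * (r *s x) $ 2 + c * (r *s x) $ 3 =
          r * (a * x $ 1 + b * x $ 2 + c * x $ 3)"
        by (simp add: algebra_simps)
      then show ?thesis using that by (simp add: H_def)
    qed
  qed (simp add: H_def)
  have span: "vec.span (insert e H) = UNIV"
  proof -
    have "v \<in> vec.span (insert e H)" for v
    proof -
      define k where "k = a * v $ 1 + b * v $ 2 + c * v $ 3"
      have "a * (v - k *s e) $ 1 + b * (v - k *s e) $ 2 + c * (v - k *s e) $ 3 =
          k - k * (a * e $ 1 + b * e $ 2 + c * e $ 3)"
        by (simp add: algebra_simps k_def)
      then have "v - k *s e \<in> H"
        using e by (simp add: H_def)
      then have "k *s e + (v - k *s e) \<in> vec.span (insert e H)"
        by (intro vec.span_add vec.span_scale vec.span_base) auto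
      then show ?thesis by simp
    qed
    then show ?thesis by blast
  qed
  have "e \<notin> vec.span H"
    using e H by (simp add: vec.span_eq_iff[THEN iffD2] H_def)
  then have "vec.dim (insert e H) = vec.dim H + 1"
    by (simp add: vec.dim_insert)
  moreover have "vec.dim (insert e H) = 3"
    using vec.dim_span[of "insert e H"] vec_dim_card[where 'a = complex and 'n = 3] span by simp
  ultimately show ?thesis
    by (simp add: H_def)
qed

text \<open>The curves contribute the whole plane. Subtracting from a tangent vector the vector of
  the plane with the same first two entries leaves a vertical one, and the equation \<open>F\<close>
  alone forbids those.\<close>

lemma tangent_space_graph:
  fixes X :: "(complex ^ 3) set"
  assumes "polyfun F" "\<And>x. x \<in> X \<Longrightarrow> F x = 0"
    and vertical: "\<And>d. dir_deriv F m (vector [0, 0, d]) = 0 \<Longrightarrow> d = 0"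
    and curves: "\<And>v1 v2. \<exists>h. (h has_field_derivative (p * v1 + q * v2)) (at 0) \<and> h 0 = m $ 3 \<and>
          eventually (\<lambda>w. vector [m $ 1 + w * v1, m $ 2 + w * v2, h w] \<in> X) (nhds 0)"
  shows "tangent_space X m = {v. v $ 3 = p * v $ 1 + q * v $ 2}"
proof -
  have graph: "vector [v1, v2, p * v1 + q * v2] \<in> tangent_space X m" for v1 v2
  proof -
    obtain h where "(h has_field_derivative (p * v1 + q * v2)) (at 0)" "h 0 = m $ 3"
      "eventually (\<lambda>w. vector [m $ 1 + w * v1, m $ 2 + w * v2, h w] \<in> X) (nhds 0)"
      using curves by blast
    then show ?thesis
      by (intro tangent_vector3I) (auto intro!: vec3_eqI derivative_eq_intros)
  qed
  have "v $ 3 = p * v $ 1 + q * v $ 2" if "v \<in> tangent_space X m" for v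
  proof -
    define d where "d = v $ 3 - (p * v $ 1 + q * v $ 2)"
    have "v - vector [v $ 1, v $ 2, p * v $ 1 + q * v $ 2] \<in> tangent_space X m"
      using that graph by (intro vec.subspace_diff subspace_tangent_space)
    also have "v - vector [v $ 1, v $ 2, p * v $ 1 + q * v $ 2] = vector [0, 0, d]"
      by (rule vec3_eqI) (auto simp: d_def)
    finally have "dir_deriv F m (vector [0, 0, d]) = 0"
      using assms(1,2) by (auto simp: tangent_space_def vanishing_ideal_def polyfun_iff)
    then have "d = 0"
      by (rule vertical)
    then show ?thesis
      by (simp add: d_def)
  qed
  moreover have "v \<in> tangent_space X m" if "v $ 3 = p * v $ 1 + q * v $ 2" for v
  proof -
    have "v = vector [v $ 1, v $ 2, p * v $ 1 + q * v $ 2]"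
      using that by (intro vec3_eqI) auto
    then show ?thesis using graph by metis
  qed
  ultimately show ?thesis by blast
qed

lemma dim_graph_tangent: "vec.dim {v :: complex ^ 3. v $ 3 = p * v $ 1 + q * v $ 2} = 2"
proof -
  have "{v :: complex ^ 3. v $ 3 = p * v $ 1 + q * v $ 2} = {v. p * v $ 1 + q * v $ 2 + (-1) * v $ 3 = 0}"
    by (auto simp: algebra_simps)
  then show ?thesis
    using dim_hyperplane3[of p q "-1"] by simp
qed

lemma dir_deriv_sq_dist: "dir_deriv (sq_dist u) m v = (\<Sum>i\<in>UNIV. 2 * (m $ i - u $ i) * v $ i)"
  unfolding sq_dist_def by (intro dir_deriv_eqI) (auto intro!: derivative_eq_intros sum.cong)

lemma critical_on_graph_iff:
  fixes m u :: "complex ^ 3"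
  shows "(\<forall>v\<in>{v. v $ 3 = p * v $ 1 + q * v $ 2}. dir_deriv (sq_dist u) m v = 0) \<longleftrightarrow>
     m $ 1 - u $ 1 + p * (m $ 3 - u $ 3) = 0 \<and> m $ 2 - u $ 2 + q * (m $ 3 - u $ 3) = 0"
    (is "?L \<longleftrightarrow> ?R")
proof
  assume L: ?L
  have "dir_deriv (sq_dist u) m (vector [1, 0, p]) = 0" "dir_deriv (sq_dist u) m (vector [0, 1, q]) = 0"
    using L by auto
  then have "2 * (m $ 1 - u $ 1 + p * (m $ 3 - u $ 3)) = 0" "2 * (m $ 2 - u $ 2 + q * (m $ 3 - u $ 3)) = 0"
    unfolding dir_deriv_sq_dist sum_3 by (simp_all add: algebra_simps)
  then show ?R
    by (metis mult_eq_0_iff zero_neq_numeral)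
next
  assume R: ?R
  show ?L
  proof clarify
    fix v :: "complex ^ 3" assume v: "v $ 3 = p * v $ 1 + q * v $ 2"
    have "dir_deriv (sq_dist u) m v = 2 * (v $ 1 * (m $ 1 - u $ 1 + p * (m $ 3 - u $ 3)) +
        v $ 2 * (m $ 2 - u $ 2 + q * (m $ 3 - u $ 3)))"
      by (simp add: dir_deriv_sq_dist sum_3 v algebra_simps)
    then show "dir_deriv (sq_dist u) m v = 0"
      using R by simp
  qed
qed

text \<open>At a point of the chart \<open>m\<^sub>3 = h(m\<^sub>1, m\<^sub>2)\<close> the slopes \<open>p\<close> and \<open>q\<close> are the partial
  derivatives of \<open>h\<close>; the remaining points are excluded by a tangent vector along which the
  distance is not stationary.\<close>

lemma critical_points_graph:
  fixes X :: "(complex ^ 3) set"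
  assumes chart: "\<And>m. m \<in> X \<Longrightarrow> D m \<Longrightarrow> tangent_space X m = {v. v $ 3 = p m * v $ 1 + q m * v $ 2}"
    and dim: "\<And>m. m \<in> X \<Longrightarrow> \<not> D m \<Longrightarrow> vec.dim (tangent_space X m) \<ge> 2"
    and rest: "\<And>m. m \<in> X \<Longrightarrow> \<not> D m \<Longrightarrow> \<exists>v\<in>tangent_space X m. dir_deriv (sq_dist u) m v \<noteq> 0"
  shows "critical_points X u = {m \<in> X. D m \<and>
     m $ 1 - u $ 1 + p m * (m $ 3 - u $ 3) = 0 \<and> m $ 2 - u $ 2 + q m * (m $ 3 - u $ 3) = 0}"
proof -
  \<comment> \<open>Smoothness means minimal tangent dimension, so the bound 2 at every point makes
    the chart points smooth; whether the other points are smooth can stay open.\<close>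
  have "vec.dim (tangent_space X m) \<ge> 2" if "m \<in> X" for m
    using that dim chart dim_graph_tangent by (cases "D m") auto
  then have "m \<in> smooth_locus X" if "m \<in> X" "D m" for m
    using that chart dim_graph_tangent by (simp add: smooth_locus_def)
  moreover have "m \<in> X" if "m \<in> smooth_locus X" for m
    using that by (simp add: smooth_locus_def)
  ultimately have "m \<in> critical_points X u \<longleftrightarrow> m \<in> X \<and> D m \<and>
      (\<forall>v\<in>{v. v $ 3 = p m * v $ 1 + q m * v $ 2}. dir_deriv (sq_dist u) m v = 0)" for m
    unfolding critical_points_def using rest chart by (cases "m \<in> X"; cases "D m") auto
  then show ?thesis
    unfolding critical_on_graph_iff by blast
qed

section \<open>Affine charts of projective closures\<close>

text \<open>The form \<open>Fh\<close> is one of the tests defining the closure, which gives one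
  inclusion. The hypothesis \<open>dense\<close> gives the other one, and is stated for arbitrary
  \<open>p\<close> because continuity arguments do not see homogeneity.\<close>

lemma affine_part_proj_closure:
  fixes Fh :: "complex ^ 4 \<Rightarrow> complex"
  assumes "graded_polyfun {d} Fh" "\<And>y. y \<in> S \<Longrightarrow> Fh y = 0"
    and dense: "\<And>p (m :: complex ^ 3). (\<And>y. y \<in> S \<Longrightarrow> eval_poly p y = 0) \<Longrightarrow>
        Fh (vector [1, m $ 1, m $ 2, m $ 3]) = 0 \<Longrightarrow> eval_poly p (vector [1, m $ 1, m $ 2, m $ 3]) = 0"
  shows "affine_part (proj_zariski_closure S) = {m. Fh (vector [1, m $ 1, m $ 2, m $ 3]) = 0}"
proof -
  obtain P where P: "homogeneous P" "Fh = eval_poly P"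
    using assms(1) by (auto simp: graded_polyfun_def homogeneous_def)
  have nz: "vector [1, m $ 1, m $ 2, m $ 3] \<noteq> (0 :: complex ^ 4)" for m :: "complex ^ 3"
  proof
    assume "vector [1, m $ 1, m $ 2, m $ 3] = (0 :: complex ^ 4)"
    then have "(vector [1, m $ 1, m $ 2, m $ 3] :: complex ^ 4) $ 1 = 0"
      by simp
    then show False by (simp add: vector_def)
  qed
  show ?thesis
    unfolding affine_part_def proj_zariski_closure_def
    using P assms(2) dense nz by auto
qed

lemma vector_4:
  "(vector [w, x, y, z] :: 'a::zero ^ 4) $ 1 = w"
  "(vector [w, x, y, z] :: 'a ^ 4) $ 2 = x"
  "(vector [w, x, y, z] :: 'a ^ 4) $ 3 = y"
  "(vector [w, x, y, z] :: 'a ^ 4) $ 4 = z"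
  unfolding vector_def by simp_all

section \<open>The inverse Gaussian and gamma surfaces\<close>

definition moment_surface :: "complex \<Rightarrow> complex \<Rightarrow> complex \<Rightarrow> (complex ^ 3) set" where
  "moment_surface \<alpha> \<beta> \<gamma> =
     {m. m $ 1 * m $ 3 = \<alpha> * (m $ 2)\<^sup>2 - \<beta> * (m $ 1)\<^sup>2 * m $ 2 + \<gamma> * (m $ 1) ^ 4}"

text \<open>With m1 = \<alpha> t^2 and m2 = t s the only fraction \<alpha> m2^2 / m1 becomes s^2.
  The parametrization is thus polynomial and also covers the line m1 = m2 = 0, which the moment
  points meet only at the origin.\<close>

lemma moment_surface_param:
  assumes "m \<in> moment_surface \<alpha> \<beta> \<gamma>" "\<alpha> \<noteq> 0"
  obtains t s where
    "m = vector [\<alpha> * t\<^sup>2, t * s, s\<^sup>2 - \<beta> * \<alpha> * s * t ^ 3 + \<gamma> * \<alpha> ^ 3 * t ^ 6]"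
proof -
  have surf: "m $ 1 * m $ 3 = \<alpha> * (m $ 2)\<^sup>2 - \<beta> * (m $ 1)\<^sup>2 * m $ 2 + \<gamma> * (m $ 1) ^ 4"
    using assms(1) by (simp add: moment_surface_def)
  define t where "t = csqrt (m $ 1 / \<alpha>)"
  have m1: "m $ 1 = \<alpha> * t\<^sup>2"
    using assms(2) by (simp add: t_def)
  show ?thesis
  proof (cases "t = 0")
    case True
    then have "m $ 1 = 0" "m $ 2 = 0"
      using m1 surf assms(2) by auto
    then have "m = vector [\<alpha> * t\<^sup>2, t * csqrt (m $ 3),
        (csqrt (m $ 3))\<^sup>2 - \<beta> * \<alpha> * csqrt (m $ 3) * t ^ 3 + \<gamma> * \<alpha> ^ 3 * t ^ 6]"
      using True by (intro vec3_eqI) auto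
    then show ?thesis by (rule that)
  next
    case False
    define s where "s = m $ 2 / t"
    have m2: "m $ 2 = t * s"
      using False by (simp add: s_def)
    have "\<alpha> * t\<^sup>2 * m $ 3 = \<alpha> * (t * s)\<^sup>2 - \<beta> * (\<alpha> * t\<^sup>2)\<^sup>2 * (t * s) + \<gamma> * (\<alpha> * t\<^sup>2) ^ 4"
      using surf by (simp only: m1 m2)
    also have "\<dots> = \<alpha> * t\<^sup>2 * (s\<^sup>2 - \<beta> * \<alpha> * s * t ^ 3 + \<gamma> * \<alpha> ^ 3 * t ^ 6)"
      by Groebner_Basis.algebra
    finally have "m $ 3 = s\<^sup>2 - \<beta> * \<alpha> * s * t ^ 3 + \<gamma> * \<alpha> ^ 3 * t ^ 6"
      using False assms(2) by simp
    then have "m = vector [\<alpha> * t\<^sup>2, t * s, s\<^sup>2 - \<beta> * \<alpha> * s * t ^ 3 + \<gamma> * \<alpha> ^ 3 * t ^ 6]"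
      using m1 m2 by (intro vec3_eqI) auto
    then show ?thesis by (rule that)
  qed
qed

section \<open>Density of the moment points in their surface\<close>

lemma continuous_on_eval_poly_curve:
  assumes "\<And>i. continuous_on UNIV (\<lambda>w. \<gamma> w $ i)"
  shows "continuous_on UNIV (\<lambda>w. eval_poly p (\<gamma> w))"
  by (induction rule: eval_poly_induct) (auto intro!: continuous_intros assms)

lemma eval_poly_vanishes_on_curve:
  fixes x y z :: "complex \<Rightarrow> complex"
  assumes "continuous_on UNIV x" "continuous_on UNIV y" "continuous_on UNIV z"
    and "\<And>w. w \<noteq> a \<Longrightarrow> eval_poly p (vector [1, x w, y w, z w] :: complex ^ 4) = 0"
  shows "eval_poly p (vector [1, x a, y a, z a] :: complex ^ 4) = 0"
proof -
  let ?f = "\<lambda>w. eval_poly p (vector [1, x w, y w, z w] :: complex ^ 4)"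
  have "continuous_on UNIV (\<lambda>w. (vector [1, x w, y w, z w] :: complex ^ 4) $ i)" for i
    using exhaust_4[of i] assms(1-3) by (auto simp: vector_4)
  then have "continuous_on UNIV ?f"
    by (rule continuous_on_eval_poly_curve)
  then have "(?f \<longlongrightarrow> ?f a) (at a)"
    by (simp add: continuous_on_eq_continuous_at isCont_def)
  moreover have "(?f \<longlongrightarrow> 0) (at a)"
    by (rule tendsto_eventually) (auto simp: eventually_at_filter assms(4))
  ultimately show ?thesis
    by (rule tendsto_unique[rotated]) simp
qed

text \<open>The points with m2 = m1^2 (variance zero) or m1 = 0 come from no parameters, apart from
  the origin. They are limits: for fixed t \<noteq> 0 first s approaches the excluded value, then
  for fixed s the parameter t tends to 0.\<close>

lemma affine_part_moment_surface:
  assumes "\<alpha> \<noteq> 0"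
    and sub: "\<And>y. y \<in> S \<Longrightarrow> y $ 1 = 1 \<and> vector [y $ 2, y $ 3, y $ 4] \<in> moment_surface \<alpha> \<beta> \<gamma>"
    and sup: "\<And>m. m \<in> moment_surface \<alpha> \<beta> \<gamma> \<Longrightarrow> m $ 1 \<noteq> 0 \<Longrightarrow> m $ 2 \<noteq> (m $ 1)\<^sup>2 \<Longrightarrow>
      vector [1, m $ 1, m $ 2, m $ 3] \<in> S"
  shows "affine_part (proj_zariski_closure S) = moment_surface \<alpha> \<beta> \<gamma>"
proof -
  \<comment> \<open>The surface equation made homogeneous of degree 4 by powers of m0, which is
    \<open>x $ 1\<close>.\<close>
  define Fh :: "complex ^ 4 \<Rightarrow> complex" where
    "Fh x = (x $ 1)\<^sup>2 * (x $ 2 * x $ 4) - \<alpha> * ((x $ 1)\<^sup>2 * (x $ 3)\<^sup>2) + \<beta> * (x $ 1 * ((x $ 2)\<^sup>2 * x $ 3))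
       - \<gamma> * (x $ 2) ^ 4" for x
  have Fh: "{m. Fh (vector [1, m $ 1, m $ 2, m $ 3]) = 0} = moment_surface \<alpha> \<beta> \<gamma>"
    by (auto simp: Fh_def moment_surface_def vector_4 algebra_simps)
  have comp: "graded_polyfun {1} (\<lambda>x :: complex ^ 4. x $ i)" for i
    by (rule graded_polyfun_component) simp
  have power: "graded_polyfun {n} (\<lambda>x :: complex ^ 4. (x $ i) ^ n)" for i n
    using graded_polyfun_power[OF comp, of n] by simp
  have "graded_polyfun {4} Fh"
    unfolding Fh_def
    by (intro graded_polyfun_add graded_polyfun_diff graded_polyfun_cmult power
        graded_polyfun_mult[OF power graded_polyfun_mult[OF comp comp, where M = "{2}"]]
        graded_polyfun_mult[OF power power]
        graded_polyfun_mult[OF comp graded_polyfun_mult[OF power comp, where M = "{3}"]]) auto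
  moreover have "Fh y = 0" if "y \<in> S" for y
    using sub[OF that] by (simp add: Fh_def moment_surface_def algebra_simps)
  moreover have "eval_poly p (vector [1, m $ 1, m $ 2, m $ 3]) = 0"
    if p: "\<And>y. y \<in> S \<Longrightarrow> eval_poly p y = 0" and "Fh (vector [1, m $ 1, m $ 2, m $ 3]) = 0" for p and m :: "complex ^ 3"
  proof -
    define z where "z t s = s\<^sup>2 - \<beta> * \<alpha> * s * t ^ 3 + \<gamma> * \<alpha> ^ 3 * t ^ 6" for t s
    have "m \<in> moment_surface \<alpha> \<beta> \<gamma>"
      using that Fh by blast
    then obtain t s where m: "m = vector [\<alpha> * t\<^sup>2, t * s, z t s]"
      unfolding z_def by (rule moment_surface_param) (rule assms(1))
    \<comment> \<open>In the coordinates (t, s) the condition m2 \<noteq> m1^2 reads t s \<noteq>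
      \<alpha>^2 t^4.\<close>
    have generic: "eval_poly p (vector [1, \<alpha> * t\<^sup>2, t * s, z t s]) = 0" if "t \<noteq> 0" "s \<noteq> \<alpha>\<^sup>2 * t ^ 3" for t s
    proof -
      have "t * s \<noteq> (\<alpha> * t\<^sup>2)\<^sup>2"
        using that by (auto simp: power2_eq_square power3_eq_cube)
      moreover have "\<alpha> * t\<^sup>2 * z t s = \<alpha> * (t * s)\<^sup>2 - \<beta> * (\<alpha> * t\<^sup>2)\<^sup>2 * (t * s) + \<gamma> * (\<alpha> * t\<^sup>2) ^ 4"
        unfolding z_def by Groebner_Basis.algebra
      ultimately show ?thesis
        using sup[of "vector [\<alpha> * t\<^sup>2, t * s, z t s]"] p that assms(1) by (simp add: moment_surface_def)
    qed
    have z_cont: "continuous_on UNIV (z t)" "continuous_on UNIV (\<lambda>t. z t s)" for t s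
      unfolding z_def by (auto intro!: continuous_intros)
    have nonzero: "eval_poly p (vector [1, \<alpha> * t\<^sup>2, t * s, z t s]) = 0" if "t \<noteq> 0" for t s
    proof (cases "s = \<alpha>\<^sup>2 * t ^ 3")
      case True
      show ?thesis
        unfolding True
        by (rule eval_poly_vanishes_on_curve[where x = "\<lambda>_. \<alpha> * t\<^sup>2" and y = "\<lambda>s. t * s" and z = "z t"])
          (auto intro!: continuous_intros z_cont generic that)
    qed (rule generic[OF that])
    have "eval_poly p (vector [1, \<alpha> * t\<^sup>2, t * s, z t s]) = 0"
    proof (cases "t = 0")
      case True
      show ?thesis
        unfolding True
        by (rule eval_poly_vanishes_on_curve[where x = "\<lambda>t. \<alpha> * t\<^sup>2" and y = "\<lambda>t. t * s" and z = "\<lambda>t. z t s"])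
          (auto intro!: continuous_intros z_cont nonzero)
    qed (rule nonzero)
    then show ?thesis
      by (simp add: m)
  qed
  ultimately have "affine_part (proj_zariski_closure S) = {m. Fh (vector [1, m $ 1, m $ 2, m $ 3]) = 0}"
    by (rule affine_part_proj_closure)
  then show ?thesis
    using Fh by simp
qed

text \<open>Dividing the equation by m1 presents the surface as the graph of \<alpha> m2^2 / m1 -
  \<beta> m1 m2 + \<gamma> m1^3. The vertical derivative of the undivided equation is m1, so
  \<open>m $ 1 \<noteq> 0\<close> serves both bounds.\<close>

lemma tangent_space_moment_surface:
  assumes "m \<in> moment_surface \<alpha> \<beta> \<gamma>" "m $ 1 \<noteq> 0"
  shows "tangent_space (moment_surface \<alpha> \<beta> \<gamma>) m =
    {v. v $ 3 = (3 * \<gamma> * (m $ 1)\<^sup>2 - \<beta> * m $ 2 - \<alpha> * (m $ 2)\<^sup>2 / (m $ 1)\<^sup>2) * v $ 1 +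
       (2 * \<alpha> * m $ 2 / m $ 1 - \<beta> * m $ 1) * v $ 2}"
proof (rule tangent_space_graph)
  let ?F = "\<lambda>x :: complex ^ 3. x $ 1 * x $ 3 - (\<alpha> * (x $ 2)\<^sup>2 - \<beta> * (x $ 1)\<^sup>2 * x $ 2 + \<gamma> * (x $ 1) ^ 4)"
  show "polyfun ?F"
    by (intro polyfun_intros) auto
  show "?F x = 0" if "x \<in> moment_surface \<alpha> \<beta> \<gamma>" for x
    using that by (simp add: moment_surface_def)
  show "d = 0" if "dir_deriv ?F m (vector [0, 0, d]) = 0" for d
  proof -
    have "dir_deriv ?F m (vector [0, 0, d]) = m $ 1 * d"
      by (rule dir_deriv_eqI) (auto intro!: derivative_eq_intros)
    then show ?thesis using that assms(2) by simp
  qed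
  fix v1 v2
  define h where "h w = \<alpha> * (m $ 2 + w * v2)\<^sup>2 / (m $ 1 + w * v1) - \<beta> * (m $ 1 + w * v1) * (m $ 2 + w * v2)
      + \<gamma> * (m $ 1 + w * v1) ^ 3" for w
  have "(h has_field_derivative ((3 * \<gamma> * (m $ 1)\<^sup>2 - \<beta> * m $ 2 - \<alpha> * (m $ 2)\<^sup>2 / (m $ 1)\<^sup>2) * v1 +
       (2 * \<alpha> * m $ 2 / m $ 1 - \<beta> * m $ 1) * v2)) (at 0)"
    unfolding h_def using assms(2)
    by (auto intro!: derivative_eq_intros) (simp add: field_simps power2_eq_square power3_eq_cube)
  moreover have "h 0 = m $ 3"
    using assms by (simp add: h_def moment_surface_def field_simps power2_eq_square power3_eq_cube power4_eq_xxxx)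
  moreover have "eventually (\<lambda>w. vector [m $ 1 + w * v1, m $ 2 + w * v2, h w] \<in> moment_surface \<alpha> \<beta> \<gamma>) (nhds 0)"
  proof -
    have "((\<lambda>w. m $ 1 + w * v1) \<longlongrightarrow> m $ 1 + 0 * v1) (nhds 0)"
      by (intro tendsto_intros filterlim_ident)
    then have "eventually (\<lambda>w. m $ 1 + w * v1 \<noteq> 0) (nhds 0)"
      by (rule tendsto_imp_eventually_ne) (use assms(2) in auto)
    moreover have "x * (\<alpha> * y\<^sup>2 / x - \<beta> * x * y + \<gamma> * x ^ 3) = \<alpha> * y\<^sup>2 - \<beta> * x\<^sup>2 * y + \<gamma> * x ^ 4"
      if "x \<noteq> 0" for x y
      using that by (simp add: algebra_simps power2_eq_square power3_eq_cube power4_eq_xxxx)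
    ultimately show ?thesis
      unfolding moment_surface_def h_def mem_Collect_eq vector_3 by (auto elim: eventually_mono)
  qed
  ultimately show "\<exists>h. (h has_field_derivative ((3 * \<gamma> * (m $ 1)\<^sup>2 - \<beta> * m $ 2 - \<alpha> * (m $ 2)\<^sup>2 / (m $ 1)\<^sup>2) * v1 +
       (2 * \<alpha> * m $ 2 / m $ 1 - \<beta> * m $ 1) * v2)) (at 0) \<and> h 0 = m $ 3 \<and>
       eventually (\<lambda>w. vector [m $ 1 + w * v1, m $ 2 + w * v2, h w] \<in> moment_surface \<alpha> \<beta> \<gamma>) (nhds 0)"
    by blast
qed

text \<open>The origin is the singular point of the surface. The tangent vectors there come from the
  curves obtained by scaling both parameters of the parametrization by the square root of \<open>w\<close>.\<close>

lemma tangent_space_moment_surface_line: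
  assumes "m \<in> moment_surface \<alpha> \<beta> \<gamma>" "m $ 1 = 0" "\<alpha> \<noteq> 0"
  shows "vector [0, 1, 0] \<in> tangent_space (moment_surface \<alpha> \<beta> \<gamma>) m"
    and "vector [0, 0, 1] \<in> tangent_space (moment_surface \<alpha> \<beta> \<gamma>) m"
proof -
  let ?X = "moment_surface \<alpha> \<beta> \<gamma>"
  have m2: "m $ 2 = 0"
    using assms by (simp add: moment_surface_def)
  show "vector [0, 0, 1] \<in> tangent_space ?X m"
    by (rule tangent_vector3I[where x = "\<lambda>_. 0" and y = "\<lambda>_. 0" and z = "\<lambda>w. m $ 3 + w"])
      (auto intro!: derivative_eq_intros vec3_eqI simp: assms m2 moment_surface_def)
  show "vector [0, 1, 0] \<in> tangent_space ?X m"
  proof (cases "m $ 3 = 0")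
    case True
    have scaled: "vector [\<alpha>, b, 1] \<in> tangent_space ?X m" if "b\<^sup>2 = 1" for b
    proof (rule tangent_vector3I[where x = "\<lambda>w. \<alpha> * w" and y = "\<lambda>w. b * w"
          and z = "\<lambda>w. w - \<beta> * \<alpha> * b * w\<^sup>2 + \<gamma> * \<alpha> ^ 3 * w ^ 3"])
      have "\<alpha> * w * (w - \<beta> * \<alpha> * b * w\<^sup>2 + \<gamma> * \<alpha> ^ 3 * w ^ 3) =
          \<alpha> * (b * w)\<^sup>2 - \<beta> * (\<alpha> * w)\<^sup>2 * (b * w) + \<gamma> * (\<alpha> * w) ^ 4" for w
        by (simp only: power_mult_distrib that) Groebner_Basis.algebra
      then show "eventually (\<lambda>w. vector [\<alpha> * w, b * w, w - \<beta> * \<alpha> * b * w\<^sup>2 + \<gamma> * \<alpha> ^ 3 * w ^ 3] \<in> ?X) (nhds 0)"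
        by (simp add: moment_surface_def)
    qed (auto intro!: derivative_eq_intros vec3_eqI simp: assms m2 True)
    have "(1 / 2) *s (vector [\<alpha>, 1, 1] - vector [\<alpha>, -1, 1]) \<in> tangent_space ?X m"
      by (intro vec.subspace_scale vec.subspace_diff subspace_tangent_space scaled) auto
    also have "(1 / 2) *s (vector [\<alpha>, 1, 1] - vector [\<alpha>, -1, 1]) = (vector [0, 1, 0] :: complex ^ 3)"
      by (rule vec3_eqI) auto
    finally show ?thesis .
  next
    case False
    \<comment> \<open>Keeping s fixed and moving t = w / s changes m1 at order two and m3 at order
      three at least, so to first order only m2 moves.\<close>
    define s where "s = csqrt (m $ 3)"
    have s: "s\<^sup>2 = m $ 3" "s \<noteq> 0"
      using False by (auto simp: s_def)
    show ?thesis
    proof (rule tangent_vector3I[where x = "\<lambda>w. \<alpha> * (w / s)\<^sup>2" and y = "\<lambda>w. (w / s) * s"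
          and z = "\<lambda>w. s\<^sup>2 - \<beta> * \<alpha> * s * (w / s) ^ 3 + \<gamma> * \<alpha> ^ 3 * (w / s) ^ 6"])
      have "\<alpha> * t\<^sup>2 * (s\<^sup>2 - \<beta> * \<alpha> * s * t ^ 3 + \<gamma> * \<alpha> ^ 3 * t ^ 6) =
          \<alpha> * (t * s)\<^sup>2 - \<beta> * (\<alpha> * t\<^sup>2)\<^sup>2 * (t * s) + \<gamma> * (\<alpha> * t\<^sup>2) ^ 4" for t
        by Groebner_Basis.algebra
      then show "eventually (\<lambda>w. vector [\<alpha> * (w / s)\<^sup>2, (w / s) * s,
          s\<^sup>2 - \<beta> * \<alpha> * s * (w / s) ^ 3 + \<gamma> * \<alpha> ^ 3 * (w / s) ^ 6] \<in> ?X) (nhds 0)"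
        unfolding moment_surface_def mem_Collect_eq vector_3 by (intro always_eventually allI)
    qed (auto intro!: derivative_eq_intros vec3_eqI simp: assms m2 s)
  qed
qed

text \<open>On the surface m1 = 0 forces m2 = 0. There the m2 and m3 directions are tangent, and
  along the former the squared distance has derivative -2 \<open>u $ 2\<close>, so none of these
  points is critical.\<close>

lemma critical_points_moment_surface:
  assumes "\<alpha> \<noteq> 0" "u $ 2 \<noteq> 0"
  shows "critical_points (moment_surface \<alpha> \<beta> \<gamma>) u = {m \<in> moment_surface \<alpha> \<beta> \<gamma>. m $ 1 \<noteq> 0 \<and>
     m $ 1 - u $ 1 + (3 * \<gamma> * (m $ 1)\<^sup>2 - \<beta> * m $ 2 - \<alpha> * (m $ 2)\<^sup>2 / (m $ 1)\<^sup>2) * (m $ 3 - u $ 3) = 0 \<and>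
     m $ 2 - u $ 2 + (2 * \<alpha> * m $ 2 / m $ 1 - \<beta> * m $ 1) * (m $ 3 - u $ 3) = 0}"
proof (rule critical_points_graph)
  fix m assume m: "m \<in> moment_surface \<alpha> \<beta> \<gamma>" "\<not> m $ 1 \<noteq> 0"
  let ?T = "tangent_space (moment_surface \<alpha> \<beta> \<gamma>) m"
  have T: "vector [0, 1, 0] \<in> ?T" "vector [0, 0, 1] \<in> ?T"
    using tangent_space_moment_surface_line[of m] m assms by auto
  have "{v :: complex ^ 3. 1 * v $ 1 + 0 * v $ 2 + 0 * v $ 3 = 0} \<subseteq> ?T"
  proof clarify
    fix v :: "complex ^ 3" assume "1 * v $ 1 + 0 * v $ 2 + 0 * v $ 3 = 0"
    then have "v = v $ 2 *s vector [0, 1, 0] + v $ 3 *s vector [0, 0, 1]"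
      by (intro vec3_eqI) auto
    moreover have "v $ 2 *s vector [0, 1, 0] + v $ 3 *s vector [0, 0, 1] \<in> ?T"
      by (intro vec.subspace_add vec.subspace_scale subspace_tangent_space T)
    ultimately show "v \<in> ?T" by simp
  qed
  then have "vec.dim {v :: complex ^ 3. 1 * v $ 1 + 0 * v $ 2 + 0 * v $ 3 = 0} \<le> vec.dim ?T"
    by (rule vec.dim_subset)
  moreover have "vec.dim {v :: complex ^ 3. 1 * v $ 1 + 0 * v $ 2 + 0 * v $ 3 = 0} = 2"
    by (rule dim_hyperplane3) simp
  ultimately show "vec.dim ?T \<ge> 2"
    by linarith
  have "m $ 2 = 0"
    using m assms by (simp add: moment_surface_def)
  then have "dir_deriv (sq_dist u) m (vector [0, 1, 0]) \<noteq> 0"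
    using assms(2) by (simp add: dir_deriv_sq_dist sum_3)
  then show "\<exists>v\<in>?T. dir_deriv (sq_dist u) m v \<noteq> 0"
    using T by blast
qed (rule tangent_space_moment_surface)

section \<open>Equations of the inverse Gaussian and gamma varieties\<close>

lemma affine_part_inverse_gaussian: "affine_part M3_inverse_gaussian = moment_surface 3 3 1"
  unfolding M3_inverse_gaussian_def
proof (rule affine_part_moment_surface)
  have moments: "moment_point (inverse_gaussian_moment \<mu> l) =
      vector [1, \<mu>, \<mu> ^ 3 / l + \<mu>\<^sup>2, 3 * (\<mu>\<^sup>2 / l) * (\<mu> ^ 3 / l + \<mu>\<^sup>2) + \<mu> ^ 3]" for \<mu> l
    by (simp add: moment_point_def eval_nat_numeral algebra_simps)
  show "y $ 1 = 1 \<and> vector [y $ 2, y $ 3, y $ 4] \<in> moment_surface 3 3 1"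
    if y_in: "y \<in> {moment_point (inverse_gaussian_moment \<mu> l) |\<mu> l. l \<noteq> 0}" for y
  proof -
    obtain \<mu> l where y: "y = moment_point (inverse_gaussian_moment \<mu> l)" "l \<noteq> 0"
      using y_in by blast
    \<comment> \<open>Writing \<open>i\<close> for the inverse of \<open>l\<close> turns the claim
      into a polynomial identity.\<close>
    have "\<mu> * (3 * (\<mu>\<^sup>2 * i) * (\<mu> ^ 3 * i + \<mu>\<^sup>2) + \<mu> ^ 3) =
        3 * (\<mu> ^ 3 * i + \<mu>\<^sup>2)\<^sup>2 - 3 * \<mu>\<^sup>2 * (\<mu> ^ 3 * i + \<mu>\<^sup>2) + 1 * \<mu> ^ 4" for i
      by Groebner_Basis.algebra
    then show ?thesis
      unfolding y(1) moments vector_4 vector_3 moment_surface_def mem_Collect_eq divide_inverse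
      by (intro conjI refl)
  qed
  fix m assume m: "m \<in> moment_surface 3 3 1" "m $ 1 \<noteq> 0" "m $ 2 \<noteq> (m $ 1)\<^sup>2"
  \<comment> \<open>Solves m2 = \<mu>^3 / l + \<mu>^2 for \<open>l\<close>; the two excluded loci
    are exactly where this is zero or undefined.\<close>
  define l where "l = (m $ 1) ^ 3 / (m $ 2 - (m $ 1)\<^sup>2)"
  have l: "(m $ 1) ^ 3 / l = m $ 2 - (m $ 1)\<^sup>2" "l \<noteq> 0"
    using m by (auto simp: l_def)
  have l': "(m $ 1)\<^sup>2 / l = (m $ 2 - (m $ 1)\<^sup>2) / m $ 1"
    using m by (simp add: l_def field_simps power2_eq_square power3_eq_cube)
  have "m $ 3 = 3 * ((m $ 2 - (m $ 1)\<^sup>2) / m $ 1) * m $ 2 + (m $ 1) ^ 3"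
    using m by (simp add: moment_surface_def field_simps power2_eq_square power3_eq_cube power4_eq_xxxx)
  then have "vector [1, m $ 1, m $ 2, m $ 3] = moment_point (inverse_gaussian_moment (m $ 1) l)"
    unfolding moments l l' by simp
  then show "vector [1, m $ 1, m $ 2, m $ 3] \<in> {moment_point (inverse_gaussian_moment \<mu> l) |\<mu> l. l \<noteq> 0}"
    using l(2) by blast
qed simp

lemma affine_part_gamma: "affine_part M3_gamma = moment_surface 2 1 0"
  unfolding M3_gamma_def
proof (rule affine_part_moment_surface)
  have moments: "moment_point (gamma_moment k \<theta>) =
      vector [1, k * \<theta>, k * \<theta> * (k * \<theta> + \<theta>), k * \<theta> * (k * \<theta> + \<theta>) * (k * \<theta> + 2 * \<theta>)]" for k \<theta>
    by (simp add: moment_point_def gamma_moment_def eval_nat_numeral algebra_simps)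
  show "y $ 1 = 1 \<and> vector [y $ 2, y $ 3, y $ 4] \<in> moment_surface 2 1 0"
    if y_in: "y \<in> {moment_point (gamma_moment k \<theta>) |k \<theta>. True}" for y
  proof -
    obtain k \<theta> where y: "y = moment_point (gamma_moment k \<theta>)"
      using y_in by blast
    show ?thesis
      by (simp add: y moments vector_4 moment_surface_def) Groebner_Basis.algebra
  qed
  fix m assume m: "m \<in> moment_surface 2 1 0" "m $ 1 \<noteq> 0" "m $ 2 \<noteq> (m $ 1)\<^sup>2"
  \<comment> \<open>The scale is variance over mean, hence nonzero here.\<close>
  define \<theta> where "\<theta> = (m $ 2 - (m $ 1)\<^sup>2) / m $ 1"
  define k where "k = m $ 1 / \<theta>"
  have k: "k * \<theta> = m $ 1"
    using m by (simp add: k_def \<theta>_def)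
  have "m $ 1 * (m $ 1 + \<theta>) = m $ 2"
    using m by (simp add: \<theta>_def field_simps power2_eq_square)
  moreover have "m $ 2 * (m $ 1 + 2 * \<theta>) = m $ 3"
    using m by (simp add: \<theta>_def moment_surface_def field_simps power2_eq_square)
  ultimately have "vector [1, m $ 1, m $ 2, m $ 3] = moment_point (gamma_moment k \<theta>)"
    by (simp add: moments k)
  then show "vector [1, m $ 1, m $ 2, m $ 3] \<in> {moment_point (gamma_moment k \<theta>) |k \<theta>. True}"
    by blast
qed simp

section \<open>Elimination\<close>

text \<open>Up to sign, \<open>N\<close> times \<open>elim_res\<close> is the resultant in \<open>q\<close> of \<open>e3 q\<^sup>3 + e1 q + N\<close> and
  \<open>f2 q\<^sup>2 + f1 q + g N\<close>. Subtracting \<open>g\<close> times the cubic from the quadratic leaves \<open>q\<close> times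
  \<open>- g e3 q\<^sup>2 + f2 q + f1 - g e1\<close>, so \<open>elim_res\<close> describes the common roots of the cubic and the
  latter quadratic. There \<open>elim_lead\<close> is the coefficient of \<open>q\<close> in the linear subresultant.\<close>

definition elim_res :: "'a::comm_ring_1 \<Rightarrow> 'a \<Rightarrow> 'a \<Rightarrow> 'a \<Rightarrow> 'a \<Rightarrow> 'a \<Rightarrow> 'a" where
  "elim_res e3 e1 N f2 f1 g = N * f2 ^ 3 - f1 * f2\<^sup>2 * e1 - e3 * f1 ^ 3 + 3 * g * e3 * N * f1 * f2
     + g * e1 * e3 * f1\<^sup>2 + g * (f2 * e1 - g * e3 * N)\<^sup>2"

definition elim_lead :: "'a::comm_ring_1 \<Rightarrow> 'a \<Rightarrow> 'a \<Rightarrow> 'a \<Rightarrow> 'a" where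
  "elim_lead e3 f2 f1 g = f2\<^sup>2 + g * e3 * f1"

lemma common_root_imp_elim:
  fixes q :: complex
  assumes "e3 * q ^ 3 + e1 * q + N = 0" "- g * e3 * q\<^sup>2 + f2 * q + f1 - g * e1 = 0"
  shows "elim_res e3 e1 N f2 f1 g = 0"
    and "elim_lead e3 f2 f1 g * q = - (f2 * (f1 - g * e1) + g\<^sup>2 * e3 * N)"
  using assms unfolding elim_res_def elim_lead_def by Groebner_Basis.algebra+

text \<open>The candidate q is the root of the linear subresultant, a fraction with denominator
  \<open>A\<close>. Clearing denominators needs \<open>A ^ 3\<close> in the cubic and the square of
  \<open>A\<close> in the quadratic; both then follow from \<open>elim_res = 0\<close>.\<close>

lemma elim_imp_common_root:
  fixes q :: complex
  assumes "elim_res e3 e1 N f2 f1 g = 0" "elim_lead e3 f2 f1 g = A" "A \<noteq> 0"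
    and "A * q = - (f2 * (f1 - g * e1) + g\<^sup>2 * e3 * N)"
  shows "e3 * q ^ 3 + e1 * q + N = 0" "- g * e3 * q\<^sup>2 + f2 * q + f1 - g * e1 = 0"
proof -
  have "A ^ 3 * (e3 * q ^ 3 + e1 * q + N) = 0"
    using assms(1,2,4) unfolding elim_res_def elim_lead_def by Groebner_Basis.algebra
  then show "e3 * q ^ 3 + e1 * q + N = 0"
    using assms(3) by simp
  have "A\<^sup>2 * (- g * e3 * q\<^sup>2 + f2 * q + f1 - g * e1) = 0"
    using assms(1,2,4) unfolding elim_res_def elim_lead_def by Groebner_Basis.algebra
  then show "- g * e3 * q\<^sup>2 + f2 * q + f1 - g * e1 = 0"
    using assms(3) by simp
qed

text \<open>\<open>elim_res\<close> is a ring expression and so commutes with evaluation: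
  elimination over polynomials in X specializes to elimination at a single value of X.\<close>

lemma poly_elim_res:
  "poly (elim_res e3 e1 N f2 f1 g) X =
     elim_res (poly e3 X) (poly e1 X) (poly N X) (poly f2 X) (poly f1 X) (poly g X)"
  by (simp add: elim_res_def)

lemma poly_elim_lead:
  "poly (elim_lead e3 f2 f1 g) X = elim_lead (poly e3 X) (poly f2 X) (poly f1 X) (poly g X)"
  by (simp add: elim_lead_def)

text \<open>Over a root of the eliminant the linear subresultant has a nonzero coefficient and
  determines q uniquely. The first hypothesis keeps X = 0, where m1 vanishes, from being a
  root.\<close>

lemma bij_betw_common_roots:
  fixes e3 e1 N f2 f1 g :: "complex poly"
  assumes "poly (elim_res e3 e1 N f2 f1 g) 0 \<noteq> 0"
    and "\<forall>X. \<not> (poly (elim_res e3 e1 N f2 f1 g) X = 0 \<and> poly (elim_lead e3 f2 f1 g) X = 0)"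
  shows "bij_betw fst {(X, q). X \<noteq> 0 \<and> poly e3 X * q ^ 3 + poly e1 X * q + poly N X = 0 \<and>
      - poly g X * poly e3 X * q\<^sup>2 + poly f2 X * q + poly f1 X - poly g X * poly e1 X = 0}
    {X. poly (elim_res e3 e1 N f2 f1 g) X = 0}"
    (is "bij_betw fst ?Z ?R")
proof -
  define P A where "P = elim_res e3 e1 N f2 f1 g" and "A = elim_lead e3 f2 f1 g"
  define B where "B X = - (poly f2 X * (poly f1 X - poly g X * poly e1 X) + (poly g X)\<^sup>2 * poly e3 X * poly N X)" for X
  define C where "C X q \<longleftrightarrow> poly e3 X * q ^ 3 + poly e1 X * q + poly N X = 0 \<and>
      - poly g X * poly e3 X * q\<^sup>2 + poly f2 X * q + poly f1 X - poly g X * poly e1 X = 0" for X q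
  have elim: "poly P X = 0" "poly A X * q = B X" if "C X q" for X q
    using common_root_imp_elim[of "poly e3 X" q "poly e1 X" "poly N X" "poly g X" "poly f2 X" "poly f1 X"] that
    unfolding P_def A_def B_def C_def poly_elim_res poly_elim_lead by simp_all
  have root: "C X (B X / poly A X)" if "poly P X = 0" for X
  proof -
    have nonzero: "poly A X \<noteq> 0"
      using that assms(2) by (auto simp: P_def A_def)
    have "poly A X * (B X / poly A X) = B X"
      using nonzero by simp
    moreover have "elim_lead (poly e3 X) (poly f2 X) (poly f1 X) (poly g X) = poly A X"
      by (simp add: A_def poly_elim_lead)
    ultimately have "poly e3 X * (B X / poly A X) ^ 3 + poly e1 X * (B X / poly A X) + poly N X = 0"
      "- poly g X * poly e3 X * (B X / poly A X)\<^sup>2 + poly f2 X * (B X / poly A X) + poly f1 X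
         - poly g X * poly e1 X = 0"
      using elim_imp_common_root[OF that[unfolded P_def poly_elim_res] _ nonzero] unfolding B_def by metis+
    then show ?thesis
      unfolding C_def by (rule conjI)
  qed
  have "bij_betw fst {(X, q). X \<noteq> 0 \<and> C X q} {X. poly P X = 0}"
  proof (rule bij_betwI')
    show "fst x \<in> {X. poly P X = 0}" if "x \<in> {(X, q). X \<noteq> 0 \<and> C X q}" for x
      using that elim by auto
    show "fst x = fst y \<longleftrightarrow> x = y"
      if "x \<in> {(X, q). X \<noteq> 0 \<and> C X q}" "y \<in> {(X, q). X \<noteq> 0 \<and> C X q}" for x y
    proof
      assume eq: "fst x = fst y"
      have "C (fst x) (snd x)" "C (fst x) (snd y)"
        using that eq by auto
      then have "poly A (fst x) * snd x = poly A (fst x) * snd y" "poly A (fst x) \<noteq> 0"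
        using elim assms(2) by (auto simp: P_def A_def)
      then show "x = y"
        using eq by (simp add: prod_eq_iff)
    qed simp
    show "\<exists>x\<in>{(X, q). X \<noteq> 0 \<and> C X q}. X = fst x" if "X \<in> {X. poly P X = 0}" for X
    proof (rule bexI)
      show "(X, B X / poly A X) \<in> {(X, q). X \<noteq> 0 \<and> C X q}"
        using that root assms(1) by (auto simp: P_def)
    qed simp
  qed
  then show ?thesis
    unfolding C_def P_def .
qed

text \<open>Here \<open>m\<^sub>1 = 2X\<close>, and the shift in \<open>m\<^sub>2 = 2X (q + (\<beta> / \<alpha>) X)\<close> completes the square.\<close>

definition surface_point :: "complex \<Rightarrow> complex \<Rightarrow> complex \<Rightarrow> complex \<Rightarrow> complex \<Rightarrow> complex ^ 3" where
  "surface_point \<alpha> \<beta> \<gamma> X q = vector [2 * X, 2 * X * (q + \<beta> / \<alpha> * X),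
     2 * \<alpha> * X * (q + \<beta> / \<alpha> * X)\<^sup>2 - 4 * \<beta> * X\<^sup>2 * (q + \<beta> / \<alpha> * X) + 8 * \<gamma> * X ^ 3]"

text \<open>All critical points have m1 \<noteq> 0, so (X, q) are coordinates for them. The shift is
  chosen so that the slope in the m2 direction is just \<open>2 * \<alpha> * q\<close>.\<close>

lemma critical_points_eq_image:
  assumes "\<alpha> \<noteq> 0" "u $ 2 \<noteq> 0"
  shows "critical_points (moment_surface \<alpha> \<beta> \<gamma>) u = (\<lambda>(X, q). surface_point \<alpha> \<beta> \<gamma> X q) ` {(X, q). X \<noteq> 0 \<and>
     2 * X - u $ 1 + (12 * \<gamma> * X\<^sup>2 - 2 * \<beta> * X * (q + \<beta> / \<alpha> * X) - \<alpha> * (q + \<beta> / \<alpha> * X)\<^sup>2) *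
       (surface_point \<alpha> \<beta> \<gamma> X q $ 3 - u $ 3) = 0 \<and>
     2 * X * (q + \<beta> / \<alpha> * X) - u $ 2 + 2 * \<alpha> * q * (surface_point \<alpha> \<beta> \<gamma> X q $ 3 - u $ 3) = 0}"
    (is "?C = _ ` ?Z")
proof -
  have comps: "surface_point \<alpha> \<beta> \<gamma> X q $ 1 = 2 * X"
    "surface_point \<alpha> \<beta> \<gamma> X q $ 2 = 2 * X * (q + \<beta> / \<alpha> * X)" for X q
    by (simp_all add: surface_point_def)
  have "2 * X * (2 * \<alpha> * X * r\<^sup>2 - 4 * \<beta> * X\<^sup>2 * r + 8 * \<gamma> * X ^ 3) =
      \<alpha> * (2 * X * r)\<^sup>2 - \<beta> * (2 * X)\<^sup>2 * (2 * X * r) + \<gamma> * (2 * X) ^ 4" for X r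
    by Groebner_Basis.algebra
  then have in_surface: "surface_point \<alpha> \<beta> \<gamma> X q \<in> moment_surface \<alpha> \<beta> \<gamma>" for X q
    unfolding moment_surface_def surface_point_def mem_Collect_eq vector_3 .
  have equiv: "surface_point \<alpha> \<beta> \<gamma> X q \<in> ?C \<longleftrightarrow> (X, q) \<in> ?Z" if "X \<noteq> 0" for X q
  proof -
    define r where "r = q + \<beta> / \<alpha> * X"
    have r: "2 * \<alpha> * r - 2 * \<beta> * X = 2 * \<alpha> * q"
      using assms(1) unfolding r_def by (simp add: distrib_left)
    have "\<alpha> * (2 * X * r)\<^sup>2 / (2 * X)\<^sup>2 = \<alpha> * r\<^sup>2" "2 * \<alpha> * (2 * X * r) / (2 * X) = 2 * \<alpha> * r"
      using that by (simp_all add: power_mult_distrib)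
    moreover have "3 * \<gamma> * (2 * X)\<^sup>2 - \<beta> * (2 * X * r) - k = 12 * \<gamma> * X\<^sup>2 - 2 * \<beta> * X * r - k" for k
      by (simp add: power_mult_distrib)
    moreover have "2 * \<alpha> * r - \<beta> * (2 * X) = 2 * \<alpha> * q"
      using r by (simp only: mult.assoc mult.left_commute[of \<beta>])
    ultimately have slopes: "3 * \<gamma> * (2 * X)\<^sup>2 - \<beta> * (2 * X * r) - \<alpha> * (2 * X * r)\<^sup>2 / (2 * X)\<^sup>2 =
        12 * \<gamma> * X\<^sup>2 - 2 * \<beta> * X * r - \<alpha> * r\<^sup>2"
      "2 * \<alpha> * (2 * X * r) / (2 * X) - \<beta> * (2 * X) = 2 * \<alpha> * q"
      by (simp_all only:)
    have "2 * X \<noteq> 0"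
      using that by simp
    then show ?thesis
      using in_surface[of X q] that
      unfolding critical_points_moment_surface[OF assms] mem_Collect_eq prod.case comps r_def[symmetric] slopes
      by blast
  qed
  have "m \<in> (\<lambda>(X, q). surface_point \<alpha> \<beta> \<gamma> X q) ` ?Z" if "m \<in> ?C" for m
  proof -
    define X where "X = m $ 1 / 2"
    define q where "q = m $ 2 / m $ 1 - \<beta> / \<alpha> * X"
    have m: "m \<in> moment_surface \<alpha> \<beta> \<gamma>" "m $ 1 \<noteq> 0"
      using that unfolding critical_points_moment_surface[OF assms] by auto
    have "q + \<beta> / \<alpha> * X = m $ 2 / m $ 1"
      unfolding q_def by (rule diff_add_cancel)
    then have c: "surface_point \<alpha> \<beta> \<gamma> X q $ 1 = m $ 1" "surface_point \<alpha> \<beta> \<gamma> X q $ 2 = m $ 2"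
      using m(2) unfolding comps by (simp_all add: X_def)
    have "m $ 1 * surface_point \<alpha> \<beta> \<gamma> X q $ 3 = m $ 1 * m $ 3"
      using m(1) in_surface[of X q] unfolding moment_surface_def mem_Collect_eq c by (rule trans[OF _ sym, rotated])
    then have "surface_point \<alpha> \<beta> \<gamma> X q $ 3 = m $ 3"
      using m(2) mult_left_cancel by blast
    then have eq: "surface_point \<alpha> \<beta> \<gamma> X q = m"
      using c by (intro vec3_eqI)
    have "X \<noteq> 0"
      using m(2) by (simp add: X_def)
    moreover have "surface_point \<alpha> \<beta> \<gamma> X q \<in> ?C"
      unfolding eq by (rule that)
    ultimately have "(X, q) \<in> ?Z"
      by (rule equiv[THEN iffD1])
    moreover have "m = (\<lambda>(X, q). surface_point \<alpha> \<beta> \<gamma> X q) (X, q)"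
      using eq by simp
    ultimately show ?thesis
      by (rule rev_image_eqI)
  qed
  moreover have "m \<in> ?C" if "m \<in> (\<lambda>(X, q). surface_point \<alpha> \<beta> \<gamma> X q) ` ?Z" for m
    using that
  proof (rule imageE)
    fix z assume m: "m = (\<lambda>(X, q). surface_point \<alpha> \<beta> \<gamma> X q) z" and z: "z \<in> ?Z"
    obtain X q where Xq: "z = (X, q)"
      by fastforce
    have "X \<noteq> 0"
      using z unfolding Xq by blast
    then have "surface_point \<alpha> \<beta> \<gamma> X q \<in> ?C"
      using z[unfolded Xq] by (rule equiv[THEN iffD2])
    then show "m \<in> ?C"
      unfolding m Xq prod.case .
  qed
  ultimately show ?thesis
    by (intro equalityI subsetI)
qed

lemma inj_on_surface_point: "inj_on (\<lambda>(X, q). surface_point \<alpha> \<beta> \<gamma> X q) {(X, q). X \<noteq> 0 \<and> Q X q}"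
proof (rule inj_onI, clarify)
  fix X q X' q'
  assume eq: "surface_point \<alpha> \<beta> \<gamma> X q = surface_point \<alpha> \<beta> \<gamma> X' q'" and "X \<noteq> 0"
  have "surface_point \<alpha> \<beta> \<gamma> X q $ 1 = surface_point \<alpha> \<beta> \<gamma> X' q' $ 1"
    "surface_point \<alpha> \<beta> \<gamma> X q $ 2 = surface_point \<alpha> \<beta> \<gamma> X' q' $ 2"
    using eq by simp_all
  then show "X = X' \<and> q = q'"
    using \<open>X \<noteq> 0\<close> unfolding surface_point_def vector_3 by simp
qed

text \<open>The degrees and the equivalence \<open>critical\<close> are required at every data
  point, the nonvanishing conditions at \<open>u0\<close> only. These include
  \<open>u0 $ 2 \<noteq> 0\<close>, which rules out the origin as base point.\<close>

lemma has_ED_degree_moment_surface: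
  fixes e3 e1 N f2 f1 g :: "complex ^ 3 \<Rightarrow> complex poly"
  defines "P \<equiv> \<lambda>u. elim_res (e3 u) (e1 u) (N u) (f2 u) (f1 u) (g u)"
    and "A \<equiv> \<lambda>u. elim_lead (e3 u) (f2 u) (f1 u) (g u)"
  assumes M: "affine_part M = moment_surface \<alpha> \<beta> \<gamma>" "\<alpha> \<noteq> 0"
    and coeffs: "polyfun_coeffs e3" "polyfun_coeffs e1" "polyfun_coeffs N"
      "polyfun_coeffs f2" "polyfun_coeffs f1" "polyfun_coeffs g"
    and degree: "\<And>u. degree (P u) = d" "\<And>u. degree (A u) = n" "d \<noteq> 0"
    and u0: "u0 $ 2 \<noteq> 0" "poly (P u0) 0 \<noteq> 0"
      "\<And>z. poly (P u0) z = 0 \<Longrightarrow> poly (pderiv (P u0)) z = 0 \<Longrightarrow> False"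
      "\<And>z. poly (P u0) z = 0 \<Longrightarrow> poly (A u0) z = 0 \<Longrightarrow> False"
    and critical: "\<And>u X q.
      2 * X - u $ 1 + (12 * \<gamma> * X\<^sup>2 - 2 * \<beta> * X * (q + \<beta> / \<alpha> * X) - \<alpha> * (q + \<beta> / \<alpha> * X)\<^sup>2) *
        (surface_point \<alpha> \<beta> \<gamma> X q $ 3 - u $ 3) = 0 \<and>
      2 * X * (q + \<beta> / \<alpha> * X) - u $ 2 + 2 * \<alpha> * q * (surface_point \<alpha> \<beta> \<gamma> X q $ 3 - u $ 3) = 0 \<longleftrightarrow>
      poly (e3 u) X * q ^ 3 + poly (e1 u) X * q + poly (N u) X = 0 \<and>
      - poly (g u) X * poly (e3 u) X * q\<^sup>2 + poly (f2 u) X * q + poly (f1 u) X - poly (g u) X * poly (e1 u) X = 0"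
  shows "has_ED_degree M d"
proof -
  have P: "polyfun_coeffs P"
    unfolding P_def elim_res_def by (intro polyfun_intros coeffs)
  have A: "polyfun_coeffs A"
    unfolding A_def elim_lead_def by (intro polyfun_intros coeffs)
  have "polyfun (\<lambda>u. poly (P u) 0)"
    using P by (simp add: polyfun_coeffs_def poly_0_coeff_0)
  then have "generic_at u0 (\<lambda>u. (u $ 2 \<noteq> 0 \<and> poly (P u) 0 \<noteq> 0) \<and> card {z. poly (P u) z = 0} = d \<and>
      (\<forall>z. \<not> (poly (P u) z = 0 \<and> poly (A u) z = 0)))"
    using u0 degree
    by (intro generic_at_conj generic_at_nonzero generic_card_roots[OF P] generic_no_common_root[OF P A])
      (auto intro: graded_polyfun_component)
  then show ?thesis
    unfolding has_ED_degree_def M(1)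
  proof (rule generic_at_imp_generically, elim conjE)
    fix u
    assume u: "u $ 2 \<noteq> 0" "poly (P u) 0 \<noteq> 0" "card {z. poly (P u) z = 0} = d"
      "\<forall>z. \<not> (poly (P u) z = 0 \<and> poly (A u) z = 0)"
    let ?Z = "{(X, q). X \<noteq> 0 \<and> poly (e3 u) X * q ^ 3 + poly (e1 u) X * q + poly (N u) X = 0 \<and>
      - poly (g u) X * poly (e3 u) X * q\<^sup>2 + poly (f2 u) X * q + poly (f1 u) X - poly (g u) X * poly (e1 u) X = 0}"
    have bij: "bij_betw fst ?Z {X. poly (P u) X = 0}"
      using u unfolding P_def A_def by (intro bij_betw_common_roots)
    have crit: "critical_points (moment_surface \<alpha> \<beta> \<gamma>) u = (\<lambda>(X, q). surface_point \<alpha> \<beta> \<gamma> X q) ` ?Z"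
      unfolding critical_points_eq_image[OF M(2) u(1)] critical ..
    have "finite {X. poly (P u) X = 0}"
      using u(2) by (intro poly_roots_finite) auto
    then have "finite ?Z"
      using bij bij_betw_finite by blast
    moreover have "card ?Z = d"
      using bij_betw_same_card[OF bij] u(3) by simp
    ultimately show "finite (critical_points (moment_surface \<alpha> \<beta> \<gamma>) u) \<and>
        card (critical_points (moment_surface \<alpha> \<beta> \<gamma>) u) = d"
      unfolding crit by (simp only: finite_imageI card_image[OF inj_on_surface_point])
  qed
qed

section \<open>The eliminants of degree 12 and 10\<close>

lemma numeral_mult_poly: "numeral n * p = Polynomial.smult (numeral n) (p :: complex poly)"
  by (simp add: numeral_poly)

lemmas elim_poly_expand = elim_res_def elim_lead_def power2_eq_square power3_eq_cube numeral_mult_poly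

text \<open>At the data points \<open>(0, 1, 0)\<close> and \<open>(0, 2, 0)\<close> the eliminants are constant multiples of
  \<open>R (X\<^sup>2)\<close>. The nonvanishing expressions are the derivative of \<open>R\<close> and, up to a constant factor,
  \<open>elim_lead\<close>; the multipliers in the proofs are the Bezout cofactors.\<close>

lemma inverse_gaussian_witness:
  fixes w :: complex
  defines "R \<equiv> 9 - 288 * w + 2624 * w ^ 2 - 17280 * w ^ 3 + 96000 * w ^ 4 - 165888 * w ^ 5 - 442368 * w ^ 6"
  assumes "R = 0"
  shows "- 288 + 5248 * w - 51840 * w ^ 2 + 384000 * w ^ 3 - 829440 * w ^ 4 - 2654208 * w ^ 5 \<noteq> 0" (is "?R' \<noteq> 0")
    and "9 - 178 * w + 840 * w ^ 2 - 1728 * w ^ 3 \<noteq> 0" (is "?A \<noteq> 0")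
proof -
  have "R * (- 46163311134880 + 284868663934464 * w - 3415056555882624 * w ^ 2 + 2423685954396672 * w ^ 3
      + 14693373230653440 * w ^ 4) +
    ?R' * (- 2014478211141 + 18357187257596 * w - 115073414724240 * w ^ 2 + 768907469700672 * w ^ 3
      - 557003630218752 * w ^ 4 - 2448895538442240 * w ^ 5) = 164699924594688"
    unfolding R_def by (simp add: algebra_simps eval_nat_numeral)
  then show "?R' \<noteq> 0"
    using assms(2) by auto
  have "R * (59604917737 - 336482845950 * w + 815012373744 * w ^ 2) +
    ?A * (- 69816966633 + 863015762348 * w - 5375824163280 * w ^ 2 + 38350430014272 * w ^ 3
      - 93525341382144 * w ^ 4 - 208643167678464 * w ^ 5) = - 91908440064"
    unfolding R_def by (simp add: algebra_simps eval_nat_numeral)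
  then show "?A \<noteq> 0"
    using assms(2) by auto
qed

lemma gamma_witness:
  fixes w :: complex
  defines "R \<equiv> 4 - 32 * w + 75 * w ^ 2 - 16 * w ^ 4 - 384 * w ^ 5"
  assumes "R = 0"
  shows "- 32 + 150 * w - 64 * w ^ 3 - 1920 * w ^ 4 \<noteq> 0" (is "?R' \<noteq> 0")
    and "8 - 39 * w + 28 * w ^ 2 + 96 * w ^ 3 \<noteq> 0" (is "?A \<noteq> 0")
proof -
  have "R * (4371431474 - 30751955232 * w - 84199170624 * w ^ 2 - 184901281920 * w ^ 3) +
    ?R' * (651612528 - 5160992153 * w + 6280450704 * w ^ 2 + 17148002928 * w ^ 3 + 36980256384 * w ^ 4) = - 3365875000"
    unfolding R_def by (simp add: algebra_simps eval_nat_numeral)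
  then show "?R' \<noteq> 0"
    using assms(2) by auto
  have "R * (212217 - 65492 * w - 355872 * w ^ 2) +
    ?A * (- 98296 + 402421 * w + 232272 * w ^ 2 + 93904 * w ^ 3 - 1423488 * w ^ 4) = 62500"
    unfolding R_def by (simp add: algebra_simps eval_nat_numeral)
  then show "?A \<noteq> 0"
    using assms(2) by auto
qed

lemma inverse_gaussian_ED_degree: "has_ED_degree M3_inverse_gaussian 12"
proof (rule has_ED_degree_moment_surface[OF affine_part_inverse_gaussian])
  \<comment> \<open>\<open>?e3\<close>, \<open>?e1\<close>, \<open>?N\<close> are the coefficients
    of the second critical equation as a cubic in q; the shift has removed its quadratic term.
    \<open>?f2\<close>, \<open>?f1\<close>, \<open>?g\<close> encode the first equation reduced
    modulo this cubic.\<close>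
  let ?e3 = "\<lambda>u :: complex ^ 3. [:0, 36:] :: complex poly"
  let ?e1 = "\<lambda>u :: complex ^ 3. [:(-6) * u $ 3, 2, 0, 12:]"
  let ?N = "\<lambda>u :: complex ^ 3. [:(-1) * u $ 2, 0, 2:]"
  let ?f2 = "\<lambda>u :: complex ^ 3. [:(-18) * u $ 2, 0, 180:]"
  let ?f1 = "\<lambda>u :: complex ^ 3. [:6 * u $ 3 - 36 * u $ 1, 70 - 72 * u $ 2, 0, 96:]"
  let ?g = "\<lambda>u :: complex ^ 3. [:-1, 0, -18:] :: complex poly"
  \<comment> \<open>Changing the signs of m1 and m3 preserves the surface and the distance to this
    point; it acts as (X, q) to (-X, -q), so the eliminant is even.\<close>
  let ?u0 = "vector [0, 1, 0] :: complex ^ 3"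
  show "polyfun_coeffs ?e3" "polyfun_coeffs ?e1" "polyfun_coeffs ?N" "polyfun_coeffs ?f2"
    "polyfun_coeffs ?f1" "polyfun_coeffs ?g"
    by (intro polyfun_intros; simp)+
  show "degree (elim_res (?e3 u) (?e1 u) (?N u) (?f2 u) (?f1 u) (?g u)) = 12"
    "degree (elim_lead (?e3 u) (?f2 u) (?f1 u) (?g u)) = 6" for u
    unfolding elim_poly_expand by simp_all
  let ?P = "elim_res (?e3 ?u0) (?e1 ?u0) (?N ?u0) (?f2 ?u0) (?f1 ?u0) (?g ?u0)"
  have P: "?P = [:5832, 0, -186624, 0, 1700352, 0, -11197440, 0, 62208000, 0, -107495424, 0, -286654464:]"
    unfolding elim_poly_expand by simp
  have A: "elim_lead (?e3 ?u0) (?f2 ?u0) (?f1 ?u0) (?g ?u0) = [:324, 0, -6408, 0, 30240, 0, -62208:]"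
    unfolding elim_poly_expand by simp
  show "poly ?P 0 \<noteq> 0"
    unfolding P by simp
  have R: "9 - 288 * w + 2624 * w ^ 2 - 17280 * w ^ 3 + 96000 * w ^ 4 - 165888 * w ^ 5 - 442368 * w ^ 6 = 0"
    if "w = z\<^sup>2" "poly ?P z = 0" for z w
  proof -
    have "poly ?P z = 648 * (9 - 288 * w + 2624 * w ^ 2 - 17280 * w ^ 3 + 96000 * w ^ 4 - 165888 * w ^ 5 - 442368 * w ^ 6)"
      unfolding P that(1) by (simp only: poly_pCons poly_0) Groebner_Basis.algebra
    then show ?thesis
      using that(2) by (metis mult_eq_0_iff zero_neq_numeral)
  qed
  show False if z: "poly ?P z = 0" "poly (pderiv ?P) z = 0" for z
  proof -
    define w where "w = z\<^sup>2"
    have "poly (pderiv ?P) z = 1296 * z *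
        (- 288 + 5248 * w - 51840 * w ^ 2 + 384000 * w ^ 3 - 829440 * w ^ 4 - 2654208 * w ^ 5)"
      unfolding P w_def by (simp add: pderiv_pCons) Groebner_Basis.algebra
    moreover have "z \<noteq> 0"
      using z(1) unfolding P by auto
    ultimately show False
      using inverse_gaussian_witness(1)[OF R[OF w_def z(1)]] z(2) by (metis mult_eq_0_iff zero_neq_numeral)
  qed
  show False if z: "poly ?P z = 0" "poly (elim_lead (?e3 ?u0) (?f2 ?u0) (?f1 ?u0) (?g ?u0)) z = 0" for z
  proof -
    define w where "w = z\<^sup>2"
    have "poly (elim_lead (?e3 ?u0) (?f2 ?u0) (?f1 ?u0) (?g ?u0)) z = 36 * (9 - 178 * w + 840 * w ^ 2 - 1728 * w ^ 3)"
      unfolding A w_def by (simp only: poly_pCons poly_0) Groebner_Basis.algebra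
    then show False
      using inverse_gaussian_witness(2)[OF R[OF w_def z(1)]] z(2) by (metis mult_eq_0_iff zero_neq_numeral)
  qed
  fix u :: "complex ^ 3" and X q :: complex
  define a b c where "a = u $ 1" and "b = u $ 2" and "c = u $ 3"
  define V where "V = 6 * X * q\<^sup>2 + 2 * X ^ 3"
  have V: "surface_point 3 3 1 X q $ 3 = V"
    unfolding surface_point_def vector_3 V_def by simp Groebner_Basis.algebra
  define E1 where "E1 = 2 * X - a + (12 * 1 * X\<^sup>2 - 2 * 3 * X * (q + X) - 3 * (q + X)\<^sup>2) * (V - c)"
  define E2 where "E2 = 2 * X * (q + X) - b + 2 * 3 * q * (V - c)"
  have E2: "poly (?e3 u) X * q ^ 3 + poly (?e1 u) X * q + poly (?N u) X = E2"
    unfolding a_def[symmetric] b_def[symmetric] c_def[symmetric] E2_def V_def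
    by (simp only: poly_pCons poly_0) Groebner_Basis.algebra
  \<comment> \<open>The multiplier of \<open>E2\<close> is what cancels the terms in q^4 and q^3 of
    \<open>36 * E1\<close>.\<close>
  have E1: "- poly (?g u) X * poly (?e3 u) X * q\<^sup>2 + poly (?f2 u) X * q + poly (?f1 u) X - poly (?g u) X * poly (?e1 u) X
      = 36 * E1 + (18 * q + 72 * X) * E2"
    unfolding a_def[symmetric] b_def[symmetric] c_def[symmetric] E1_def E2_def V_def
    by (simp only: poly_pCons poly_0) Groebner_Basis.algebra
  have "3 / 3 * X = X"
    by simp
  then show "2 * X - u $ 1 + (12 * 1 * X\<^sup>2 - 2 * 3 * X * (q + 3 / 3 * X) - 3 * (q + 3 / 3 * X)\<^sup>2) *
        (surface_point 3 3 1 X q $ 3 - u $ 3) = 0 \<and>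
      2 * X * (q + 3 / 3 * X) - u $ 2 + 2 * 3 * q * (surface_point 3 3 1 X q $ 3 - u $ 3) = 0 \<longleftrightarrow>
      poly (?e3 u) X * q ^ 3 + poly (?e1 u) X * q + poly (?N u) X = 0 \<and>
      - poly (?g u) X * poly (?e3 u) X * q\<^sup>2 + poly (?f2 u) X * q + poly (?f1 u) X - poly (?g u) X * poly (?e1 u) X = 0"
    unfolding E1 E2 V by (simp only: a_def[symmetric] b_def[symmetric] c_def[symmetric] E1_def[symmetric] E2_def[symmetric]) auto
qed simp_all

lemma gamma_ED_degree: "has_ED_degree M3_gamma 10"
proof (rule has_ED_degree_moment_surface[OF affine_part_gamma])
  let ?e3 = "\<lambda>u :: complex ^ 3. [:0, 16:] :: complex poly"
  let ?e1 = "\<lambda>u :: complex ^ 3. [:(-4) * u $ 3, 2, 0, -4:]"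
  let ?N = "\<lambda>u :: complex ^ 3. [:(-1) * u $ 2, 0, 1:]"
  let ?f2 = "\<lambda>u :: complex ^ 3. [:(-8) * u $ 2, 0, 40:]"
  let ?f1 = "\<lambda>u :: complex ^ 3. [:4 * u $ 3 - 16 * u $ 1, 30 - 16 * u $ 2, 0, 32:]"
  let ?g = "\<lambda>u :: complex ^ 3. [:-1, 0, 6:] :: complex poly"
  let ?u0 = "vector [0, 2, 0] :: complex ^ 3"
  show "polyfun_coeffs ?e3" "polyfun_coeffs ?e1" "polyfun_coeffs ?N" "polyfun_coeffs ?f2"
    "polyfun_coeffs ?f1" "polyfun_coeffs ?g"
    by (intro polyfun_intros; simp)+
  \<comment> \<open>The coefficient 6 (-4 * 16 * 32^2 + (-4 * 40 - 6 * 16)^2) of X^12 is zero and no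
    X^11 arises, so the degree drops by two against the inverse Gaussian case.\<close>
  show "degree (elim_res (?e3 u) (?e1 u) (?N u) (?f2 u) (?f1 u) (?g u)) = 10"
    "degree (elim_lead (?e3 u) (?f2 u) (?f1 u) (?g u)) = 6" for u
    unfolding elim_poly_expand by (simp_all add: algebra_simps)
  let ?P = "elim_res (?e3 ?u0) (?e1 ?u0) (?N ?u0) (?f2 ?u0) (?f1 ?u0) (?g ?u0)"
  have P: "?P = [:8192, 0, -65536, 0, 153600, 0, 0, 0, -32768, 0, -786432:]"
    unfolding elim_poly_expand by simp
  have A: "elim_lead (?e3 ?u0) (?f2 ?u0) (?f1 ?u0) (?g ?u0) = [:256, 0, -1248, 0, 896, 0, 3072:]"
    unfolding elim_poly_expand by simp
  show "poly ?P 0 \<noteq> 0"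
    unfolding P by simp
  have R: "4 - 32 * w + 75 * w ^ 2 - 16 * w ^ 4 - 384 * w ^ 5 = 0" if "w = z\<^sup>2" "poly ?P z = 0" for z w
  proof -
    have "poly ?P z = 2048 * (4 - 32 * w + 75 * w ^ 2 - 16 * w ^ 4 - 384 * w ^ 5)"
      unfolding P that(1) by (simp only: poly_pCons poly_0) Groebner_Basis.algebra
    then show ?thesis
      using that(2) by (metis mult_eq_0_iff zero_neq_numeral)
  qed
  show False if z: "poly ?P z = 0" "poly (pderiv ?P) z = 0" for z
  proof -
    define w where "w = z\<^sup>2"
    have "poly (pderiv ?P) z = 4096 * z * (- 32 + 150 * w - 64 * w ^ 3 - 1920 * w ^ 4)"
      unfolding P w_def by (simp add: pderiv_pCons) Groebner_Basis.algebra
    moreover have "z \<noteq> 0"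
      using z(1) unfolding P by auto
    ultimately show False
      using gamma_witness(1)[OF R[OF w_def z(1)]] z(2) by (metis mult_eq_0_iff zero_neq_numeral)
  qed
  show False if z: "poly ?P z = 0" "poly (elim_lead (?e3 ?u0) (?f2 ?u0) (?f1 ?u0) (?g ?u0)) z = 0" for z
  proof -
    define w where "w = z\<^sup>2"
    have "poly (elim_lead (?e3 ?u0) (?f2 ?u0) (?f1 ?u0) (?g ?u0)) z = 32 * (8 - 39 * w + 28 * w ^ 2 + 96 * w ^ 3)"
      unfolding A w_def by (simp only: poly_pCons poly_0) Groebner_Basis.algebra
    then show False
      using gamma_witness(2)[OF R[OF w_def z(1)]] z(2) by (metis mult_eq_0_iff zero_neq_numeral)
  qed
  fix u :: "complex ^ 3" and X q :: complex
  define a b c where "a = u $ 1" and "b = u $ 2" and "c = u $ 3"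
  define Y where "Y = 1 / 2 * X"
  define V where "V = 4 * X * q\<^sup>2 - X ^ 3"
  have X: "X = 2 * Y"
    by (simp add: Y_def)
  have V: "surface_point 2 1 0 X q $ 3 = V"
    unfolding surface_point_def vector_3 V_def Y_def[symmetric] unfolding X by Groebner_Basis.algebra
  define E1 where "E1 = 2 * X - a + (12 * 0 * X\<^sup>2 - 2 * 1 * X * (q + Y) - 2 * (q + Y)\<^sup>2) * (V - c)"
  define E2 where "E2 = 2 * X * (q + Y) - b + 2 * 2 * q * (V - c)"
  have E2: "poly (?e3 u) X * q ^ 3 + poly (?e1 u) X * q + poly (?N u) X = E2"
    unfolding a_def[symmetric] b_def[symmetric] c_def[symmetric] E2_def V_def X
    by (simp only: poly_pCons poly_0) Groebner_Basis.algebra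
  \<comment> \<open>Here too the multiplier of \<open>E2\<close> cancels the terms in q^4 and
    q^3.\<close>
  have E1: "- poly (?g u) X * poly (?e3 u) X * q\<^sup>2 + poly (?f2 u) X * q + poly (?f1 u) X - poly (?g u) X * poly (?e1 u) X
      = 16 * E1 + (8 * q + 16 * X) * E2"
    unfolding a_def[symmetric] b_def[symmetric] c_def[symmetric] E1_def E2_def V_def X
    by (simp only: poly_pCons poly_0) Groebner_Basis.algebra
  show "2 * X - u $ 1 + (12 * 0 * X\<^sup>2 - 2 * 1 * X * (q + 1 / 2 * X) - 2 * (q + 1 / 2 * X)\<^sup>2) *
        (surface_point 2 1 0 X q $ 3 - u $ 3) = 0 \<and>
      2 * X * (q + 1 / 2 * X) - u $ 2 + 2 * 2 * q * (surface_point 2 1 0 X q $ 3 - u $ 3) = 0 \<longleftrightarrow>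
      poly (?e3 u) X * q ^ 3 + poly (?e1 u) X * q + poly (?N u) X = 0 \<and>
      - poly (?g u) X * poly (?e3 u) X * q\<^sup>2 + poly (?f2 u) X * q + poly (?f1 u) X - poly (?g u) X * poly (?e1 u) X = 0"
    unfolding E1 E2 V by (simp only: a_def[symmetric] b_def[symmetric] c_def[symmetric] Y_def[symmetric]
        E1_def[symmetric] E2_def[symmetric]) auto
qed simp_all

section \<open>The Gaussian surface\<close>

definition gaussian_surface :: "(complex ^ 3) set" where
  "gaussian_surface = {m. m $ 3 = 3 * m $ 1 * m $ 2 - 2 * (m $ 1) ^ 3}"

text \<open>With the variance m2 - m1^2 as parameter every point of the affine surface is itself a
  moment point, so no limits are taken.\<close>

lemma affine_part_gaussian: "affine_part M3_gaussian = gaussian_surface"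
proof -
  define Fh :: "complex ^ 4 \<Rightarrow> complex" where
    "Fh x = (x $ 1)\<^sup>2 * x $ 4 - 3 * (x $ 1 * (x $ 2 * x $ 3)) + 2 * (x $ 2) ^ 3" for x
  have Fh: "{m. Fh (vector [1, m $ 1, m $ 2, m $ 3]) = 0} = gaussian_surface"
    by (auto simp: Fh_def gaussian_surface_def vector_4 algebra_simps)
  have comp: "graded_polyfun {1} (\<lambda>x :: complex ^ 4. x $ i)" for i
    by (rule graded_polyfun_component) simp
  have power: "graded_polyfun {n} (\<lambda>x :: complex ^ 4. (x $ i) ^ n)" for i n
    using graded_polyfun_power[OF comp, of n] by simp
  have "graded_polyfun {3} Fh"
    unfolding Fh_def
    by (intro graded_polyfun_add graded_polyfun_diff graded_polyfun_cmult power
        graded_polyfun_mult[OF power comp]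
        graded_polyfun_mult[OF comp graded_polyfun_mult[OF comp comp, where M = "{2}"]]) auto
  moreover have "Fh y = 0" if y: "y \<in> {gaussian_moment_point \<mu> v |\<mu> v. True}" for y
  proof -
    obtain \<mu> v where y_eq: "y = gaussian_moment_point \<mu> v"
      using y by blast
    have "1\<^sup>2 * (\<mu> ^ 3 + 3 * \<mu> * v) - 3 * (1 * (\<mu> * (\<mu>\<^sup>2 + v))) + 2 * \<mu> ^ 3 = 0"
      by (simp only: power_one mult_1) Groebner_Basis.algebra
    then show ?thesis
      unfolding Fh_def y_eq gaussian_moment_point_def vector_4 .
  qed
  moreover have "eval_poly p (vector [1, m $ 1, m $ 2, m $ 3]) = 0"
    if p: "\<And>y. y \<in> {gaussian_moment_point \<mu> v |\<mu> v. True} \<Longrightarrow> eval_poly p y = 0"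
      and m: "Fh (vector [1, m $ 1, m $ 2, m $ 3]) = 0" for p and m :: "complex ^ 3"
  proof (rule p)
    have "m $ 3 = 3 * m $ 1 * m $ 2 - 2 * (m $ 1) ^ 3"
      using m Fh unfolding gaussian_surface_def by blast
    also have "\<dots> = (m $ 1) ^ 3 + 3 * m $ 1 * (m $ 2 - (m $ 1)\<^sup>2)"
      by Groebner_Basis.algebra
    finally have m3: "m $ 3 = (m $ 1) ^ 3 + 3 * m $ 1 * (m $ 2 - (m $ 1)\<^sup>2)" .
    have "m $ 2 = (m $ 1)\<^sup>2 + (m $ 2 - (m $ 1)\<^sup>2)"
      by simp
    with m3 have "vector [1, m $ 1, m $ 2, m $ 3] = gaussian_moment_point (m $ 1) (m $ 2 - (m $ 1)\<^sup>2)"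
      unfolding gaussian_moment_point_def by metis
    then show "vector [1, m $ 1, m $ 2, m $ 3] \<in> {gaussian_moment_point \<mu> v |\<mu> v. True}"
      by blast
  qed
  ultimately have "affine_part (proj_zariski_closure {gaussian_moment_point \<mu> v |\<mu> v. True}) =
      {m. Fh (vector [1, m $ 1, m $ 2, m $ 3]) = 0}"
    by (rule affine_part_proj_closure)
  then show ?thesis
    using Fh by (simp add: M3_gaussian_def)
qed

lemma tangent_space_gaussian_surface:
  assumes "m \<in> gaussian_surface"
  shows "tangent_space gaussian_surface m =
    {v. v $ 3 = (3 * m $ 2 - 6 * (m $ 1)\<^sup>2) * v $ 1 + 3 * m $ 1 * v $ 2}"
proof (rule tangent_space_graph)
  let ?F = "\<lambda>x :: complex ^ 3. x $ 3 - (3 * x $ 1 * x $ 2 - 2 * (x $ 1) ^ 3)"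
  show "polyfun ?F"
    by (intro polyfun_intros) auto
  show "?F x = 0" if "x \<in> gaussian_surface" for x
    using that by (simp add: gaussian_surface_def)
  show "d = 0" if "dir_deriv ?F m (vector [0, 0, d]) = 0" for d
  proof -
    have "dir_deriv ?F m (vector [0, 0, d]) = d"
      by (rule dir_deriv_eqI) (auto intro!: derivative_eq_intros)
    then show ?thesis using that by simp
  qed
  fix v1 v2
  define h where "h w = 3 * (m $ 1 + w * v1) * (m $ 2 + w * v2) - 2 * (m $ 1 + w * v1) ^ 3" for w
  have "(h has_field_derivative ((3 * m $ 2 - 6 * (m $ 1)\<^sup>2) * v1 + 3 * m $ 1 * v2)) (at 0)"
    unfolding h_def by (auto intro!: derivative_eq_intros simp: algebra_simps)
  moreover have "h 0 = m $ 3"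
    using assms by (simp add: h_def gaussian_surface_def)
  moreover have "eventually (\<lambda>w. vector [m $ 1 + w * v1, m $ 2 + w * v2, h w] \<in> gaussian_surface) (nhds 0)"
    unfolding h_def gaussian_surface_def mem_Collect_eq vector_3 by simp
  ultimately show "\<exists>h. (h has_field_derivative ((3 * m $ 2 - 6 * (m $ 1)\<^sup>2) * v1 + 3 * m $ 1 * v2)) (at 0) \<and>
       h 0 = m $ 3 \<and>
       eventually (\<lambda>w. vector [m $ 1 + w * v1, m $ 2 + w * v2, h w] \<in> gaussian_surface) (nhds 0)"
    by blast
qed

lemma critical_points_gaussian_surface:
  "critical_points gaussian_surface u = {m \<in> gaussian_surface. True \<and>
     m $ 1 - u $ 1 + (3 * m $ 2 - 6 * (m $ 1)\<^sup>2) * (m $ 3 - u $ 3) = 0 \<and>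
     m $ 2 - u $ 2 + 3 * m $ 1 * (m $ 3 - u $ 3) = 0}"
  by (rule critical_points_graph[where D = "\<lambda>_. True"]) (simp_all add: tangent_space_gaussian_surface)

text \<open>The second critical equation determines \<open>m\<^sub>2\<close> from \<open>m\<^sub>1\<close>; substituting into the first one
  and clearing denominators gives this polynomial in \<open>m\<^sub>1\<close>.\<close>

definition gaussian_eliminant :: "complex ^ 3 \<Rightarrow> complex poly" where
  "gaussian_eliminant u = [:0, 1, 0, 18, 0, 81:] - [:u $ 1, 0, 18 * u $ 1, 0, 81 * u $ 1:] -
     [:3 * u $ 2, 9 * u $ 3, -6, 0, -36:] * [:u $ 3, (-3) * u $ 2, 0, 2:]"

lemma degree_gaussian_eliminant: "degree (gaussian_eliminant u) = 7"
  unfolding gaussian_eliminant_def by simp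

lemma polyfun_coeffs_gaussian_eliminant: "polyfun_coeffs gaussian_eliminant"
  unfolding gaussian_eliminant_def by (intro polyfun_intros; simp)

lemma poly_gaussian_eliminant:
  "poly (gaussian_eliminant u) x = (x - u $ 1) * (1 + 9 * x\<^sup>2)\<^sup>2 -
     (3 * u $ 2 + 9 * u $ 3 * x - 6 * x\<^sup>2 - 36 * x ^ 4) * (u $ 3 - 3 * u $ 2 * x + 2 * x ^ 3)"
  unfolding gaussian_eliminant_def poly_diff poly_mult poly_pCons poly_0 by Groebner_Basis.algebra

text \<open>Multiplied by \<open>(1 + 9 x\<^sup>2)\<^sup>2\<close>, the first critical equation is the eliminant modulo the second.\<close>

lemma gaussian_elimination:
  fixes x y a b c :: complex
  assumes "y * (1 + 9 * x\<^sup>2) = b + 6 * x ^ 4 + 3 * c * x"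
  shows "(x - a + (3 * y - 6 * x\<^sup>2) * (3 * x * y - 2 * x ^ 3 - c)) * (1 + 9 * x\<^sup>2)\<^sup>2 =
     (x - a) * (1 + 9 * x\<^sup>2)\<^sup>2 - (3 * b + 9 * c * x - 6 * x\<^sup>2 - 36 * x ^ 4) * (c - 3 * b * x + 2 * x ^ 3)"
  using assms by Groebner_Basis.algebra

text \<open>The second critical equation is linear in m2 with coefficient 1 + 9 m1^2. The hypothesis
  keeps this nonzero at the roots of the eliminant, so each root has exactly one m2, and m3
  follows.\<close>

lemma bij_betw_gaussian_critical_points:
  assumes "\<forall>x. \<not> (poly (gaussian_eliminant u) x = 0 \<and> poly [:1, 0, 9:] x = 0)"
  shows "bij_betw (\<lambda>m. m $ 1) (critical_points gaussian_surface u) {x. poly (gaussian_eliminant u) x = 0}"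
proof -
  define a b c where "a = u $ 1" and "b = u $ 2" and "c = u $ 3"
  define C where "C x y \<longleftrightarrow> x - a + (3 * y - 6 * x\<^sup>2) * (3 * x * y - 2 * x ^ 3 - c) = 0 \<and>
      y * (1 + 9 * x\<^sup>2) = b + 6 * x ^ 4 + 3 * c * x" for x y
  have second: "y - b + 3 * x * (3 * x * y - 2 * x ^ 3 - c) = 0 \<longleftrightarrow> y * (1 + 9 * x\<^sup>2) = b + 6 * x ^ 4 + 3 * c * x" for x y
  proof -
    have "y - b + 3 * x * (3 * x * y - 2 * x ^ 3 - c) = y * (1 + 9 * x\<^sup>2) - (b + 6 * x ^ 4 + 3 * c * x)"
      by Groebner_Basis.algebra
    then show ?thesis
      by (metis right_minus_eq)
  qed
  have crit: "m \<in> critical_points gaussian_surface u \<longleftrightarrow>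
      m $ 3 = 3 * m $ 1 * m $ 2 - 2 * (m $ 1) ^ 3 \<and> C (m $ 1) (m $ 2)" for m
  proof -
    have "m \<in> gaussian_surface \<longleftrightarrow> m $ 3 = 3 * m $ 1 * m $ 2 - 2 * (m $ 1) ^ 3"
      by (simp add: gaussian_surface_def)
    then show ?thesis
      unfolding critical_points_gaussian_surface mem_Collect_eq C_def second[symmetric]
        a_def[symmetric] b_def[symmetric] c_def[symmetric]
      by auto
  qed
  have P: "poly (gaussian_eliminant u) x =
      (x - a) * (1 + 9 * x\<^sup>2)\<^sup>2 - (3 * b + 9 * c * x - 6 * x\<^sup>2 - 36 * x ^ 4) * (c - 3 * b * x + 2 * x ^ 3)" for x
    unfolding a_def b_def c_def by (rule poly_gaussian_eliminant)
  have root: "poly (gaussian_eliminant u) x = 0" if "C x y" for x y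
    using gaussian_elimination[of y x b c a] that unfolding C_def P by simp
  have nonzero: "1 + 9 * x\<^sup>2 \<noteq> 0" if "poly (gaussian_eliminant u) x = 0" for x
  proof -
    have "poly [:1, 0, 9:] x = 1 + 9 * x\<^sup>2"
      by (simp add: power2_eq_square)
    then show ?thesis
      using assms that by metis
  qed
  show ?thesis
  proof (rule bij_betwI')
    show "m $ 1 \<in> {x. poly (gaussian_eliminant u) x = 0}" if "m \<in> critical_points gaussian_surface u" for m
      using that root crit by blast
    show "m $ 1 = m' $ 1 \<longleftrightarrow> m = m'"
      if "m \<in> critical_points gaussian_surface u" "m' \<in> critical_points gaussian_surface u" for m m'
    proof
      assume eq: "m $ 1 = m' $ 1"
      have "C (m $ 1) (m $ 2)" "C (m $ 1) (m' $ 2)"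
        using that crit eq by auto
      moreover from this have "1 + 9 * (m $ 1)\<^sup>2 \<noteq> 0"
        using root nonzero by blast
      ultimately have "m $ 2 = m' $ 2"
        unfolding C_def by (metis mult_right_cancel)
      moreover have "m $ 3 = m' $ 3"
        using that crit eq \<open>m $ 2 = m' $ 2\<close> by metis
      ultimately show "m = m'"
        using eq by (intro vec3_eqI)
    qed simp
    show "\<exists>m\<in>critical_points gaussian_surface u. x = m $ 1"
      if x: "x \<in> {x. poly (gaussian_eliminant u) x = 0}" for x
    proof -
      define y where "y = (b + 6 * x ^ 4 + 3 * c * x) / (1 + 9 * x\<^sup>2)"
      have nz: "1 + 9 * x\<^sup>2 \<noteq> 0"
        using x nonzero by blast
      then have y: "y * (1 + 9 * x\<^sup>2) = b + 6 * x ^ 4 + 3 * c * x"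
        by (simp add: y_def)
      have "(x - a + (3 * y - 6 * x\<^sup>2) * (3 * x * y - 2 * x ^ 3 - c)) * (1 + 9 * x\<^sup>2)\<^sup>2 = 0"
        using gaussian_elimination[OF y, of a] x unfolding P mem_Collect_eq by metis
      then have "C x y"
        using y nz unfolding C_def by (metis mult_eq_0_iff power_not_zero)
      then have "vector [x, y, 3 * x * y - 2 * x ^ 3] \<in> critical_points gaussian_surface u"
        unfolding crit vector_3 by blast
      then show ?thesis
        by (rule bexI[rotated]) simp
    qed
  qed
qed

lemma gaussian_ED_degree: "has_ED_degree M3_gaussian 7"
proof -
  \<comment> \<open>This surface is a graph over the whole (m1, m2)-plane, so there is no
    exceptional line and the origin can serve as data point. The sign change of m1 and m3 makes the
    eliminant odd there.\<close>
  let ?P = "gaussian_eliminant 0"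
  have P: "?P = [:0, 1, 0, 18, 0, 93, 0, 72:]"
    unfolding gaussian_eliminant_def by simp
  have R: "z = 0 \<or> 1 + 18 * w + 93 * w ^ 2 + 72 * w ^ 3 = 0" if "w = z\<^sup>2" "poly ?P z = 0" for z w
  proof -
    have "poly ?P z = z * (1 + 18 * w + 93 * w ^ 2 + 72 * w ^ 3)"
      unfolding P that(1) by (simp only: poly_pCons poly_0) Groebner_Basis.algebra
    then show ?thesis
      using that(2) by (metis mult_eq_0_iff)
  qed
  have "generic_at 0 (\<lambda>u. card {x. poly (gaussian_eliminant u) x = 0} = 7)"
  proof (rule generic_card_roots[OF polyfun_coeffs_gaussian_eliminant degree_gaussian_eliminant])
    fix z assume z: "poly ?P z = 0" "poly (pderiv ?P) z = 0"
    define w where "w = z\<^sup>2"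
    have "poly (pderiv ?P) z = 1 + 54 * w + 465 * w ^ 2 + 504 * w ^ 3"
      unfolding P w_def by (simp add: pderiv_pCons) Groebner_Basis.algebra
    then have Q: "1 + 54 * w + 465 * w ^ 2 + 504 * w ^ 3 = 0"
      using z(2) by metis
    then have "z \<noteq> 0"
      by (auto simp: w_def)
    then have "1 + 18 * w + 93 * w ^ 2 + 72 * w ^ 3 = 0"
      using R[OF w_def z(1)] by blast
    \<comment> \<open>Bezout identity: with R the cubic factor of the eliminant z R(z^2), the second
      polynomial is the derivative of z R(z^2) written in \<open>w\<close>.\<close>
    moreover have "(1 + 18 * w + 93 * w ^ 2 + 72 * w ^ 3) * (- 10039 - 621183 * w - 769608 * w ^ 2) +
        (1 + 54 * w + 465 * w ^ 2 + 504 * w ^ 3) * (12455 + 129315 * w + 109944 * w ^ 2) = 2416"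
      by (simp add: algebra_simps eval_nat_numeral)
    ultimately show False
      unfolding Q by simp
  qed simp
  moreover have "generic_at 0 (\<lambda>u. \<forall>x. \<not> (poly (gaussian_eliminant u) x = 0 \<and> poly [:1, 0, 9:] x = 0))"
  proof (rule generic_no_common_root[OF polyfun_coeffs_gaussian_eliminant polyfun_coeffs_const
        degree_gaussian_eliminant refl])
    fix z assume z: "poly ?P z = 0" "poly [:1, 0, 9:] z = 0"
    define w where "w = z\<^sup>2"
    have "poly [:1, 0, 9:] z = 1 + 9 * w"
      unfolding w_def by (simp only: poly_pCons poly_0) Groebner_Basis.algebra
    then have Q: "1 + 9 * w = 0"
      using z(2) by metis
    then have "z \<noteq> 0"
      by (auto simp: w_def)
    then have "1 + 18 * w + 93 * w ^ 2 + 72 * w ^ 3 = 0"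
      using R[OF w_def z(1)] by blast
    moreover have "(1 + 18 * w + 93 * w ^ 2 + 72 * w ^ 3) * 81 + (1 + 9 * w) * (- 77 - 765 * w - 648 * w ^ 2) = 4"
      by (simp add: algebra_simps eval_nat_numeral)
    ultimately show False
      unfolding Q by simp
  qed simp
  ultimately have "generic_at 0 (\<lambda>u. card {x. poly (gaussian_eliminant u) x = 0} = 7 \<and>
      (\<forall>x. \<not> (poly (gaussian_eliminant u) x = 0 \<and> poly [:1, 0, 9:] x = 0)))"
    by (rule generic_at_conj)
  then show ?thesis
    unfolding has_ED_degree_def affine_part_gaussian
  proof (rule generic_at_imp_generically, elim conjE)
    fix u
    assume card: "card {x. poly (gaussian_eliminant u) x = 0} = 7"
      and "\<forall>x. \<not> (poly (gaussian_eliminant u) x = 0 \<and> poly [:1, 0, 9:] x = 0)"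
    then have bij: "bij_betw (\<lambda>m. m $ 1) (critical_points gaussian_surface u) {x. poly (gaussian_eliminant u) x = 0}"
      by (intro bij_betw_gaussian_critical_points)
    have "card (critical_points gaussian_surface u) = 7"
      using bij_betw_same_card[OF bij] card by simp
    moreover from this have "finite (critical_points gaussian_surface u)"
      by (intro card_ge_0_finite) simp
    ultimately show "finite (critical_points gaussian_surface u) \<and> card (critical_points gaussian_surface u) = 7"
      by blast
  qed
qed

theorem proposition5p6:
  shows "has_ED_degree M3_inverse_gaussian 12
       \<and> has_ED_degree M3_gamma 10
       \<and> has_ED_degree M3_gaussian 7"
  using inverse_gaussian_ED_degree gamma_ED_degree gaussian_ED_degree by blast

end
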